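(* Let $F = \alpha\, \phi(b^2, \frac{\beta}{\alpha})$ be a non-Riemannian Finsler metric on an $n$-dimensional manifold with $n \geq 3$, where $\alpha=\sqrt{a_{ij}(x)y^iy^j}$ is a Riemannian metric, $\beta=b_i(x)y^i$ is a $1$-form, $b=\|\beta_x\|_\alpha$, and $\phi=\phi(b^2,s)$ is a smooth function. If $\alpha$ is a projectively flat Riemannian metric and $\phi_1 \neq 0$, then $F$ is projectively flat if and only if one of the following conditions holds: (i) $\beta$ is parallel with respect to $\alpha$; (ii) there are two scalar functions $c=c(b^2)$ and $k=k(x)$ such that $$[\, c b^2 - (c-1)s^2 \,]\phi_{22} = 2 b^2 (\phi_1 - s \phi_{12})$$ and $$b_{i|j} = k c\,(b^2 a_{ij} -b_i b_j) + k\, b_i b_j .$$ In this case, the geodesic coefficients $G^i$ of $F$ and ${}^{\alpha}G^i$ of $\alpha$ are related by $$G^i={}^{\alpha}G^i + k\, \alpha\Big\{ (c-1) \frac{(b^2-s^2)\phi_2}{2\phi} + \frac{b^2(2 s \phi_1 + \phi_2)}{2\phi} \Big\}y^i, \qquad s=\frac{\beta}{\alpha}.$$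
   Context: A general $(\alpha,\beta)$-metric is a Finsler metric of the form $F=\alpha\,\phi(b^2,\beta/\alpha)$, where $\alpha=\sqrt{a_{ij}(x)y^iy^j}$ is a Riemannian metric, $\beta=b_i(x)y^i$ is a $1$-form, $b:=\|\beta_x\|_\alpha$ is the norm of $\beta$ at $x$ with respect to $\alpha$, and $\phi=\phi(b^2,s)$ is a smooth function. Write $s=\beta/\alpha$. The subscripts $1$ and $2$ on $\phi$ denote partial derivatives with respect to the first variable $b^2$ and the second variable $s$ (so $\phi_{12}=\partial^2\phi/\partial(b^2)\partial s$, $\phi_{22}=\partial^2\phi/\partial s^2$). If $\phi_1=0$, then $F$ is just an $(\alpha,\beta)$-metric $\alpha\phi(\beta/\alpha)$. $b_{i|j}$ denotes the covariant derivative of $\beta$ with respect to $\alpha$; $\beta$ is parallel with respect to $\alpha$ if $b_{i|j}=0$. For a Finsler metric $F=F(x,y)$ on an open domain $\mathcal U\subset\mathbb R^n$, with $g_{ij}=\frac12[F^2]_{y^iy^j}$ and $(g^{ij})=(g_{ij})^{-1}$, the geodesic coefficients are $$G^i=\tfrac14 g^{il}\{[F^2]_{x^my^l}y^m-[F^2]_{x^l}\},$$ so that geodesics satisfy $\ddot x^i+2G^i(x,\dot x)=0$. $F$ is projectively flat if $G^i=Py^i$, where $P=F_{x^k}y^k/(2F)$; equivalently, its geodesics are straight lines as point sets. Projective flatness of $\alpha$ and of $F$ refers to the same coordinates on $\mathcal U$. ${}^\alpha G^i$ denotes the geodesic coefficients of $\alpha$.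
   Formalization: As stated it fails at zeros of β and for F=Aα+Bβ with b constant. Here F=Aα+Bβ (A, B constants) is excluded, and the equation for b_{i|j} and the formula for G^i with k are imposed only where β≠0; the manifold is a connected open U in R^n, and φ_1 is nowhere zero. *)

theory Defs
  imports "HOL-Analysis.Analysis"
begin

text \<open>\<open>Ck_on k S f\<close> and \<open>smooth_on S f\<close> are meant for open \<open>S\<close>.\<close>

primrec Ck_on :: "nat \<Rightarrow> 'a::real_normed_vector set \<Rightarrow> ('a \<Rightarrow> 'b::real_normed_vector) \<Rightarrow> bool" where
  "Ck_on 0 S f \<longleftrightarrow> continuous_on S f"
| "Ck_on (Suc k) S f \<longleftrightarrow>
     (\<forall>x\<in>S. f differentiable (at x)) \<and> (\<forall>v. Ck_on k S (\<lambda>x. frechet_derivative f (at x) v))"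

definition smooth_on :: "'a::real_normed_vector set \<Rightarrow> ('a \<Rightarrow> 'b::real_normed_vector) \<Rightarrow> bool" where
  "smooth_on S f \<longleftrightarrow> (\<forall>k. Ck_on k S f)"

definition partial :: "'n::finite \<Rightarrow> (real^'n \<Rightarrow> real) \<Rightarrow> real^'n \<Rightarrow> real" where
  "partial i f x = frechet_derivative f (at x) (axis i 1)"

text \<open>Partial derivatives of a function of the two real variables \<open>(b\<^sup>2, s)\<close>.\<close>

definition d1 :: "(real \<Rightarrow> real \<Rightarrow> real) \<Rightarrow> real \<Rightarrow> real \<Rightarrow> real" where
  "d1 f u s = deriv (\<lambda>t. f t s) u"

definition d2 :: "(real \<Rightarrow> real \<Rightarrow> real) \<Rightarrow> real \<Rightarrow> real \<Rightarrow> real" where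
  "d2 f u s = deriv (\<lambda>t. f u t) s"


definition fundamental_tensor ::
    "(real^'n \<Rightarrow> real^'n \<Rightarrow> real) \<Rightarrow> real^'n \<Rightarrow> real^'n \<Rightarrow> real^'n^'n::finite" where
  "fundamental_tensor F x y =
     (\<chi> i j. 1/2 * partial j (\<lambda>y'. partial i (\<lambda>y''. (F x y'')\<^sup>2) y') y)"

definition finsler_metric :: "(real^'n) set \<Rightarrow> (real^'n \<Rightarrow> real^'n \<Rightarrow> real) \<Rightarrow> bool" where
  "finsler_metric U F \<longleftrightarrow>
     smooth_on (U \<times> (- {0})) (\<lambda>(x, y). F x y) \<and>
     (\<forall>x\<in>U. \<forall>y. \<forall>t>0. F x (t *\<^sub>R y) = t * F x y) \<and>
     (\<forall>x\<in>U. \<forall>y. y \<noteq> 0 \<longrightarrow> F x y > 0) \<and>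
     (\<forall>x\<in>U. \<forall>y. y \<noteq> 0 \<longrightarrow> (\<forall>v. v \<noteq> 0 \<longrightarrow> v \<bullet> (fundamental_tensor F x y *v v) > 0))"

definition geodesic_coeff ::
    "(real^'n \<Rightarrow> real^'n \<Rightarrow> real) \<Rightarrow> real^'n \<Rightarrow> real^'n \<Rightarrow> real^'n::finite" where
  "geodesic_coeff F x y = (\<chi> i. 1/4 * (\<Sum>l\<in>UNIV. matrix_inv (fundamental_tensor F x y) $ i $ l *
      ((\<Sum>m\<in>UNIV. partial l (\<lambda>y'. partial m (\<lambda>x'. (F x' y')\<^sup>2) x) y * y $ m)
        - partial l (\<lambda>x'. (F x' y)\<^sup>2) x)))"

definition projectively_flat :: "(real^'n) set \<Rightarrow> (real^'n::finite \<Rightarrow> real^'n \<Rightarrow> real) \<Rightarrow> bool" where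
  "projectively_flat U F \<longleftrightarrow> (\<forall>x\<in>U. \<forall>y. y \<noteq> 0 \<longrightarrow>
     geodesic_coeff F x y =
       ((\<Sum>k\<in>UNIV. partial k (\<lambda>x'. F x' y) x * y $ k) / (2 * F x y)) *\<^sub>R y)"


text \<open>A Riemannian metric is given by its matrix field \<open>a\<close>, a 1-form by its component field \<open>b\<close>.\<close>

definition riemannian_metric :: "(real^'n) set \<Rightarrow> (real^'n \<Rightarrow> real^'n^'n::finite) \<Rightarrow> bool" where
  "riemannian_metric U a \<longleftrightarrow> smooth_on U a \<and>
     (\<forall>x\<in>U. transpose (a x) = a x \<and> (\<forall>v. v \<noteq> 0 \<longrightarrow> v \<bullet> (a x *v v) > 0))"

definition alpha :: "(real^'n \<Rightarrow> real^'n^'n) \<Rightarrow> real^'n \<Rightarrow> real^'n::finite \<Rightarrow> real" where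
  "alpha a x y = sqrt (y \<bullet> (a x *v y))"

definition beta :: "(real^'n \<Rightarrow> real^'n) \<Rightarrow> real^'n \<Rightarrow> real^'n::finite \<Rightarrow> real" where
  "beta b x y = b x \<bullet> y"

text \<open>The squared norm \<open>b\<^sup>2 = a\<^sup>i\<^sup>j b\<^sub>i b\<^sub>j\<close> of the 1-form with respect to \<open>a\<close>.\<close>

definition bsq :: "(real^'n \<Rightarrow> real^'n^'n) \<Rightarrow> (real^'n \<Rightarrow> real^'n) \<Rightarrow> real^'n::finite \<Rightarrow> real" where
  "bsq a b x = b x \<bullet> (matrix_inv (a x) *v b x)"

definition riemannian_on :: "(real^'n) set \<Rightarrow> (real^'n::finite \<Rightarrow> real^'n \<Rightarrow> real) \<Rightarrow> bool" where
  "riemannian_on U F \<longleftrightarrow>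
     (\<exists>a. riemannian_metric U a \<and> (\<forall>x\<in>U. \<forall>y. F x y = alpha a x y))"

text \<open>\<open>christoffel a x k i j\<close> has upper index \<open>k\<close>; \<open>cov_deriv a b x i j\<close> is \<open>b\<^sub>i\<^sub>|\<^sub>j\<close>.\<close>

definition christoffel ::
    "(real^'n \<Rightarrow> real^'n^'n) \<Rightarrow> real^'n \<Rightarrow> 'n::finite \<Rightarrow> 'n \<Rightarrow> 'n \<Rightarrow> real" where
  "christoffel a x k i j = 1/2 * (\<Sum>l\<in>UNIV. matrix_inv (a x) $ k $ l *
     (partial i (\<lambda>x'. a x' $ j $ l) x + partial j (\<lambda>x'. a x' $ i $ l) x
       - partial l (\<lambda>x'. a x' $ i $ j) x))"

definition cov_deriv ::
    "(real^'n \<Rightarrow> real^'n^'n) \<Rightarrow> (real^'n \<Rightarrow> real^'n) \<Rightarrow> real^'n \<Rightarrow> 'n::finite \<Rightarrow> 'n \<Rightarrow> real" where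
  "cov_deriv a b x i j =
     partial j (\<lambda>x'. b x' $ i) x - (\<Sum>k\<in>UNIV. christoffel a x k i j * b x $ k)"

definition parallel_form ::
    "(real^'n) set \<Rightarrow> (real^'n \<Rightarrow> real^'n^'n) \<Rightarrow> (real^'n \<Rightarrow> real^'n::finite) \<Rightarrow> bool" where
  "parallel_form U a b \<longleftrightarrow> (\<forall>x\<in>U. \<forall>i j. cov_deriv a b x i j = 0)"

definition general_ab_metric ::
    "(real^'n \<Rightarrow> real^'n^'n) \<Rightarrow> (real^'n \<Rightarrow> real^'n) \<Rightarrow> (real \<Rightarrow> real \<Rightarrow> real)
      \<Rightarrow> real^'n \<Rightarrow> real^'n::finite \<Rightarrow> real" where
  "general_ab_metric a b \<phi> x y = alpha a x y * \<phi> (bsq a b x) (beta b x y / alpha a x y)"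

text \<open>
  For a fixed \<open>x\<close> the values of \<open>s = \<beta>/\<alpha>\<close> are exactly those with \<open>s\<^sup>2 \<le> b\<^sup>2\<close> (in dimension
  at least two), so \<open>phi_domain\<close> is the set of all arguments at which \<open>F\<close> evaluates \<open>\<phi>\<close>.\<close>

definition phi_domain ::
    "(real^'n) set \<Rightarrow> (real^'n \<Rightarrow> real^'n^'n) \<Rightarrow> (real^'n \<Rightarrow> real^'n::finite) \<Rightarrow> (real \<times> real) set" where
  "phi_domain U a b = {(bsq a b x, s) | x s. x \<in> U \<and> s\<^sup>2 \<le> bsq a b x}"

definition phi_equation :: "(real \<times> real) set \<Rightarrow> (real \<Rightarrow> real \<Rightarrow> real) \<Rightarrow> (real \<Rightarrow> real) \<Rightarrow> bool" where
  "phi_equation S \<phi> c \<longleftrightarrow> (\<forall>(u, s)\<in>S.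
     (c u * u - (c u - 1) * s\<^sup>2) * d2 (d2 \<phi>) u s = 2 * u * (d1 \<phi> u s - s * d1 (d2 \<phi>) u s))"

text \<open>
  The equation for \<open>b\<^sub>i\<^sub>|\<^sub>j\<close> is imposed where \<open>\<beta>\<close> does not vanish.  At a zero of \<open>\<beta>\<close> its
  right-hand side would be 0 for every finite \<open>k\<close>; for the closed conformal form
  \<open>\<beta> = \<langle>x, y\<rangle>\<close> of Euclidean space it holds with \<open>c = 1\<close> and \<open>k = 1/\<bar>x\<bar>\<^sup>2\<close>, away from the origin.\<close>

definition beta_equation ::
    "(real^'n) set \<Rightarrow> (real^'n \<Rightarrow> real^'n^'n) \<Rightarrow> (real^'n \<Rightarrow> real^'n::finite)
      \<Rightarrow> (real \<Rightarrow> real) \<Rightarrow> (real^'n \<Rightarrow> real) \<Rightarrow> bool" where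
  "beta_equation U a b c k \<longleftrightarrow> (\<forall>x\<in>U. b x \<noteq> 0 \<longrightarrow> (\<forall>i j.
     cov_deriv a b x i j =
       k x * c (bsq a b x) * (bsq a b x * a x $ i $ j - b x $ i * b x $ j)
         + k x * b x $ i * b x $ j))"

end

theory Submission
  imports Defs
begin

text \<open>
  Given \<open>G\<^sup>i = P y\<^sup>i\<close> for \<open>\<alpha>\<close>, projective flatness of \<open>F\<close> is Hamel's equation
  \<open>F\<^bsub>x\<^sup>m y\<^sup>l\<^esub> y\<^sup>m = F\<^bsub>x\<^sup>l\<^esub>\<close>, which at each point is an equation between \<open>b\<^bsub>i|j\<^esub>\<close> and the
  derivatives of \<open>\<phi>\<close>.  For \<open>n \<ge> 3\<close> there are enough vectors orthogonal to \<open>\<beta>\<close> to read off that \<open>b\<^bsub>i|j\<^esub>\<close> is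
  symmetric, has \<open>\<beta>\<close> as an eigenvector and is a multiple of the metric on its orthogonal
  complement; the ratio of the two eigenvalues is \<open>c = 2 \<phi>\<^sub>1 / \<phi>\<^sub>2\<^sub>2\<close> at \<open>s = 0\<close>.
  The remaining difficulty is global: \<open>c\<close> has to be finite on all values of \<open>b\<^sup>2\<close>, and the
  equation for \<open>\<phi>\<close> has to hold on levels of \<open>b\<^sup>2\<close> on which \<open>b\<^bsub>i|j\<^esub>\<close> vanishes.  If
  either fails at a value \<open>u\<close>, then \<open>|d(b\<^sup>2)| \<le> K |b\<^sup>2 - u|\<close> near the level \<open>b\<^sup>2 = u\<close>, so
  by Gronwall and connectedness \<open>b\<^sup>2\<close> is constant, and then \<open>\<beta>\<close> is parallel.
\<close>

section \<open>Smooth functions of two variables\<close>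

text \<open>Hamel's equation couples phi to beta through d(b^2): this differential is twice b_{i|j}
  contracted with the vector dual to beta, and the equation for phi appears multiplied by the
  corresponding eigenvalue. At a critical point of b^2 nothing about phi can be read off, although c
  and the equation for phi depend on the value b^2 alone. This is why a whole level of b^2 has to be
  examined. If b^2 is constant, phi matters on one level only. When phi_22 is not identically zero
  there, beta is parallel. Otherwise F = A alpha + B beta with constants A, B, and Hamel's equation
  asks at most that beta be closed. Then neither alternative need hold: for Euclidean alpha, beta =
  d|x| away from the origin and phi = b^2 + s/2, the metric F = alpha + beta/2 is projectively flat,
  beta is not parallel, and contracting the equation in (ii) twice with beta gives k = 0, hence
  b_{i|j} = 0, a contradiction. The hypothesis \<open>non_affine\<close> excludes this
  family.\<close>

lemma Ck_on_cong:
  assumes "open S" "\<And>x. x \<in> S \<Longrightarrow> f x = g x"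
  shows "Ck_on k S f \<longleftrightarrow> Ck_on k S g"
  using assms(2)
proof (induction k arbitrary: f g)
  case 0
  then show ?case by (auto cong: continuous_on_cong)
next
  case (Suc k)
  have der: "(f has_derivative D) (at x) \<longleftrightarrow> (g has_derivative D) (at x)" if "x \<in> S" for D x
    using has_derivative_transform_within_open[OF _ assms(1) that] Suc.prems by metis
  have "frechet_derivative f (at x) = frechet_derivative g (at x)" if "x \<in> S" for x
    using der[OF that] by (simp add: frechet_derivative_def)
  then have "Ck_on k S (\<lambda>x. frechet_derivative f (at x) v) \<longleftrightarrow>
      Ck_on k S (\<lambda>x. frechet_derivative g (at x) v)" for v
    by (intro Suc.IH) simp
  moreover have "f differentiable (at x) \<longleftrightarrow> g differentiable (at x)" if "x \<in> S" for x
    using der[OF that] by (auto simp: differentiable_def)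
  ultimately show ?case by auto
qed

lemma smooth_on_cong:
  "open S \<Longrightarrow> (\<And>x. x \<in> S \<Longrightarrow> f x = g x) \<Longrightarrow> smooth_on S f \<longleftrightarrow> smooth_on S g"
  unfolding smooth_on_def using Ck_on_cong by blast

lemma smooth_on_frechet_derivative:
  "smooth_on S f \<Longrightarrow> smooth_on S (\<lambda>x. frechet_derivative f (at x) v)"
  unfolding smooth_on_def by (metis Ck_on.simps(2))

lemma smooth_on_has_derivative:
  "smooth_on S f \<Longrightarrow> x \<in> S \<Longrightarrow> (f has_derivative frechet_derivative f (at x)) (at x)"
  unfolding smooth_on_def by (metis Ck_on.simps(2) frechet_derivative_works)

lemma smooth_on_isCont: "smooth_on S f \<Longrightarrow> x \<in> S \<Longrightarrow> isCont f x"
  using smooth_on_has_derivative has_derivative_continuous by blast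

lemma has_derivative_partials:
  assumes "((\<lambda>(u, s). f u s) has_derivative L) (at (u, s))"
  shows "((\<lambda>t. f t s) has_real_derivative L (1, 0)) (at u)"
    and "(f u has_real_derivative L (0, 1)) (at s)"
proof -
  have lin: "linear L"
    using assms has_derivative_linear by blast
  have "((\<lambda>t. (t, s)) has_derivative (\<lambda>h. (h, 0))) (at u)"
    by (auto intro!: derivative_eq_intros)
  from has_derivative_compose[OF this, of "\<lambda>(u, s). f u s" L] assms
  have *: "((\<lambda>t. f t s) has_derivative (\<lambda>h. L (h, 0))) (at u)" by simp
  have "(\<lambda>h. L (h, 0)) = (*) (L (1, 0))"
  proof
    show "L (h, 0) = L (1, 0) * h" for h
      using linear_cmul[OF lin, of h "(1, 0)"] by (simp add: mult.commute)
  qed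
  with * show "((\<lambda>t. f t s) has_real_derivative L (1, 0)) (at u)"
    by (simp only: has_field_derivative_def)
  have "((\<lambda>t. (u, t)) has_derivative (\<lambda>h. (0, h))) (at s)"
    by (auto intro!: derivative_eq_intros)
  from has_derivative_compose[OF this, of "\<lambda>(u, s). f u s" L] assms
  have *: "((\<lambda>t. f u t) has_derivative (\<lambda>h. L (0, h))) (at s)" by simp
  have "(\<lambda>h. L (0, h)) = (*) (L (0, 1))"
  proof
    show "L (0, h) = L (0, 1) * h" for h
      using linear_cmul[OF lin, of h "(0, 1)"] by (simp add: mult.commute)
  qed
  with * show "(f u has_real_derivative L (0, 1)) (at s)"
    by (simp only: has_field_derivative_def)
qed

context
  fixes D :: "(real \<times> real) set" and f :: "real \<Rightarrow> real \<Rightarrow> real"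
  assumes D: "open D" and f: "smooth_on D (\<lambda>(u, s). f u s)"
begin

lemma d1_eq_frechet:
  "(u, s) \<in> D \<Longrightarrow> d1 f u s = frechet_derivative (\<lambda>(u, s). f u s) (at (u, s)) (1, 0)"
  unfolding d1_def
  by (intro DERIV_imp_deriv has_derivative_partials(1) smooth_on_has_derivative[OF f])

lemma d2_eq_frechet:
  "(u, s) \<in> D \<Longrightarrow> d2 f u s = frechet_derivative (\<lambda>(u, s). f u s) (at (u, s)) (0, 1)"
  unfolding d2_def
  using DERIV_imp_deriv[OF has_derivative_partials(2)[OF smooth_on_has_derivative[OF f]]] by simp

lemma smooth_on_d1: "smooth_on D (\<lambda>(u, s). d1 f u s)"
  by (rule smooth_on_cong[OF D, THEN iffD2,
        OF _ smooth_on_frechet_derivative[OF f, of "(1, 0)"]])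
    (auto simp: d1_eq_frechet)

lemma smooth_on_d2: "smooth_on D (\<lambda>(u, s). d2 f u s)"
  by (rule smooth_on_cong[OF D, THEN iffD2,
        OF _ smooth_on_frechet_derivative[OF f, of "(0, 1)"]])
    (auto simp: d2_eq_frechet)

lemma has_real_derivative_d1:
  "(u, s) \<in> D \<Longrightarrow> ((\<lambda>t. f t s) has_real_derivative d1 f u s) (at u)"
  using has_derivative_partials(1)[OF smooth_on_has_derivative[OF f]] by (simp add: d1_eq_frechet)

lemma has_real_derivative_d2:
  "(u, s) \<in> D \<Longrightarrow> (f u has_real_derivative d2 f u s) (at s)"
  using has_derivative_partials(2)[OF smooth_on_has_derivative[OF f]] by (simp add: d2_eq_frechet)

lemma has_derivative_d1_d2:
  assumes "(u, s) \<in> D"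
  shows "((\<lambda>(u, s). f u s) has_derivative (\<lambda>(h, k). d1 f u s * h + d2 f u s * k)) (at (u, s))"
proof -
  define L where "L = frechet_derivative (\<lambda>(u, s). f u s) (at (u, s))"
  have L: "((\<lambda>(u, s). f u s) has_derivative L) (at (u, s))"
    unfolding L_def by (intro smooth_on_has_derivative[OF f] assms)
  then have lin: "linear L" by (rule has_derivative_linear)
  have "L (h, k) = d1 f u s * h + d2 f u s * k" for h k
  proof -
    have "L (h, k) = L (h *\<^sub>R (1, 0) + k *\<^sub>R (0, 1))" by simp
    also have "\<dots> = h * L (1, 0) + k * L (0, 1)"
      by (simp add: linear_add[OF lin] linear_cmul[OF lin] del: scaleR_Pair)
    finally show ?thesis
      using assms by (simp add: L_def d1_eq_frechet d2_eq_frechet mult.commute)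
  qed
  then have "L = (\<lambda>(h, k). d1 f u s * h + d2 f u s * k)" by auto
  with L show ?thesis by simp
qed

end

text \<open>The mean value theorem, applied in the first variable and then in the second, turns the
  second difference over a square into \<open>h^2\<close> times a mixed derivative. The second
  difference is symmetric in the variables, so their roles can be exchanged.\<close>

lemma second_difference_mvt:
  fixes f fx fxy :: "real \<Rightarrow> real \<Rightarrow> real"
  assumes "h > 0" "{u..u + h} \<times> {s..s + h} \<subseteq> D"
    and fx: "\<And>x y. (x, y) \<in> D \<Longrightarrow> ((\<lambda>t. f t y) has_real_derivative fx x y) (at x)"
    and fxy: "\<And>x y. (x, y) \<in> D \<Longrightarrow> (fx x has_real_derivative fxy x y) (at y)"
  obtains x y where "x \<in> {u..u + h}" "y \<in> {s..s + h}"
    "f (u + h) (s + h) - f u (s + h) - f (u + h) s + f u s = h\<^sup>2 * fxy x y"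
proof -
  have "\<exists>x>u. x < u + h \<and>
      (f (u + h) (s + h) - f (u + h) s) - (f u (s + h) - f u s)
        = (u + h - u) * (fx x (s + h) - fx x s)"
    using assms(1,2)
    by (intro MVT2[of u "u + h" "\<lambda>t. f t (s + h) - f t s"]) (auto intro!: DERIV_diff fx)
  then obtain x where x: "u < x" "x < u + h"
    "(f (u + h) (s + h) - f (u + h) s) - (f u (s + h) - f u s) = h * (fx x (s + h) - fx x s)"
    by auto
  have "\<exists>y>s. y < s + h \<and> fx x (s + h) - fx x s = (s + h - s) * fxy x y"
    using assms(1,2) x by (intro MVT2) (auto intro!: fxy)
  then obtain y where y: "s < y" "y < s + h" "fx x (s + h) - fx x s = h * fxy x y"
    by auto
  show ?thesis
    using that[of x y] x y by (simp add: algebra_simps power2_eq_square)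
qed

text \<open>Schwarz's theorem: both mixed derivatives take the value of the same difference quotient
  somewhere in a small square, and both are continuous at its corner. It is needed because
  differentiating \<open>d1 \<phi>\<close> along y produces \<open>d2 (d1 \<phi>)\<close>, while the
  equations are written with \<open>d1 (d2 \<phi>)\<close>.\<close>

lemma d1_d2_commute:
  assumes D: "open D" and f: "smooth_on D (\<lambda>(u, s). f u s)" and us: "(u, s) \<in> D"
  shows "d2 (d1 f) u s = d1 (d2 f) u s"
proof -
  note s1 = smooth_on_d1[OF D f] and s2 = smooth_on_d2[OF D f]
  have c: "isCont (\<lambda>(u, s). d2 (d1 f) u s) (u, s)" "isCont (\<lambda>(u, s). d1 (d2 f) u s) (u, s)"
    using smooth_on_isCont[OF smooth_on_d2[OF D s1] us] smooth_on_isCont[OF smooth_on_d1[OF D s2] us] .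
  have "\<bar>d2 (d1 f) u s - d1 (d2 f) u s\<bar> \<le> e" if "e > 0" for e
  proof -
    have "\<forall>\<^sub>F p in nhds (u, s). p \<in> D"
      using D us eventually_nhds by blast
    moreover have "\<forall>\<^sub>F p in nhds (u, s). dist ((\<lambda>(u, s). d2 (d1 f) u s) p) (d2 (d1 f) u s) < e / 2"
      "\<forall>\<^sub>F p in nhds (u, s). dist ((\<lambda>(u, s). d1 (d2 f) u s) p) (d1 (d2 f) u s) < e / 2"
      using c[unfolded isCont_def tendsto_at_iff_tendsto_nhds] tendstoD[where e = "e / 2"] that
      by fastforce+
    ultimately have "\<forall>\<^sub>F p in nhds (u, s). p \<in> D \<and>
        dist ((\<lambda>(u, s). d2 (d1 f) u s) p) (d2 (d1 f) u s) < e / 2 \<and>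
        dist ((\<lambda>(u, s). d1 (d2 f) u s) p) (d1 (d2 f) u s) < e / 2"
      by eventually_elim auto
    then obtain d where d: "d > 0" and near: "\<And>x y. dist (x, y) (u, s) < d \<Longrightarrow> (x, y) \<in> D \<and>
        \<bar>d2 (d1 f) x y - d2 (d1 f) u s\<bar> < e / 2 \<and> \<bar>d1 (d2 f) x y - d1 (d2 f) u s\<bar> < e / 2"
      unfolding eventually_nhds_metric dist_real_def by auto
    \<comment> \<open>Two sides of the square add up to 2d/3, which keeps it inside the ball of
      radius d.\<close>
    define h where "h = d / 3"
    have h: "h > 0" using d by (simp add: h_def)
    have sq: "dist (x, y) (u, s) < d" if "x \<in> {u..u + h}" "y \<in> {s..s + h}" for x y
    proof -
      have "dist (x, y) (u, s) \<le> \<bar>x - u\<bar> + \<bar>y - s\<bar>"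
        by (simp add: dist_Pair_Pair dist_real_def sqrt_sum_squares_le_sum_abs)
      with that d show ?thesis by (auto simp: h_def)
    qed
    then have sub: "{u..u + h} \<times> {s..s + h} \<subseteq> D" "{s..s + h} \<times> {u..u + h} \<subseteq> {(s, u). (u, s) \<in> D}"
      using near by auto
    obtain x y where xy: "x \<in> {u..u + h}" "y \<in> {s..s + h}"
      "f (u + h) (s + h) - f u (s + h) - f (u + h) s + f u s = h\<^sup>2 * d2 (d1 f) x y"
      by (rule second_difference_mvt[OF h sub(1),
            OF has_real_derivative_d1[OF D f] has_real_derivative_d2[OF D s1]])
    obtain y' x' where xy': "x' \<in> {u..u + h}" "y' \<in> {s..s + h}"
      "f (u + h) (s + h) - f (u + h) s - f u (s + h) + f u s = h\<^sup>2 * d1 (d2 f) x' y'"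
      by (rule second_difference_mvt[OF h sub(2), of "\<lambda>s u. f u s" "\<lambda>s u. d2 f u s" "\<lambda>s u. d1 (d2 f) u s"])
        (use has_real_derivative_d2[OF D f] has_real_derivative_d1[OF D s2] in auto)
    have "h\<^sup>2 * d2 (d1 f) x y = h\<^sup>2 * d1 (d2 f) x' y'"
      using xy(3) xy'(3) by linarith
    then have "d2 (d1 f) x y = d1 (d2 f) x' y'"
      using h by simp
    with near[OF sq[OF xy(1,2)]] near[OF sq[OF xy'(1,2)]] show ?thesis
      unfolding abs_le_iff abs_less_iff by argo
  qed
  then show ?thesis
    using field_le_epsilon[of "\<bar>d2 (d1 f) u s - d1 (d2 f) u s\<bar>" 0] by simp
qed


section \<open>The Hamel equation\<close>

lemma posdef_imp_invertible:
  fixes A :: "real^'n^'n"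
  assumes "\<And>v. v \<noteq> 0 \<Longrightarrow> v \<bullet> (A *v v) > 0"
  shows "invertible A"
proof -
  have "inj ((*v) A)"
  proof (rule injI)
    fix v w assume "A *v v = A *v w"
    then have "(v - w) \<bullet> (A *v (v - w)) = 0"
      by (simp add: matrix_vector_mult_diff_distrib)
    then show "v = w"
      using assms[of "v - w"] by force
  qed
  then show ?thesis
    by (simp add: invertible_left_inverse matrix_left_invertible_injective)
qed

lemma matrix_inv_works:
  assumes "invertible A"
  shows "A ** matrix_inv A = mat 1" "matrix_inv A ** A = mat 1"
  using someI_ex[OF assms[unfolded invertible_def]] unfolding matrix_inv_def by blast+

lemma matrix_inv_vector:
  fixes A :: "real^'n^'n"
  assumes "invertible A"
  shows "A *v (matrix_inv A *v x) = x" "matrix_inv A *v (A *v x) = x"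
  using matrix_inv_works[OF assms] by (simp_all add: matrix_vector_mul_assoc)

lemma partial_eq: "(f has_derivative f') (at x) \<Longrightarrow> partial i f x = f' (axis i 1)"
  unfolding partial_def using frechet_derivative_at by metis

lemma linear_sum_axis:
  fixes f :: "real^'n \<Rightarrow> real"
  assumes "linear f"
  shows "(\<Sum>i\<in>UNIV. f (axis i 1) * y $ i) = f y"
proof -
  have "f y = f (\<Sum>i\<in>UNIV. y $ i *\<^sub>R axis i 1)"
    using basis_expansion[of y] by (simp add: scalar_mult_eq_scaleR)
  also have "\<dots> = (\<Sum>i\<in>UNIV. f (axis i 1) * y $ i)"
    using assms by (simp add: linear_sum linear_cmul mult.commute)
  finally show ?thesis by simp
qed

lemma linear_eq_axis:
  fixes f g :: "real^'n \<Rightarrow> real"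
  assumes "linear f" "linear g" "\<And>i. f (axis i 1) = g (axis i 1)"
  shows "f y = g y"
  using linear_sum_axis[OF assms(1), of y] linear_sum_axis[OF assms(2), of y] assms(3) by simp

lemma homogeneous_euler:
  fixes f :: "'a::real_normed_vector \<Rightarrow> real"
  assumes f: "(f has_derivative f') (at y)" and hom: "\<And>t. t > 0 \<Longrightarrow> f (t *\<^sub>R y) = t * f y"
  shows "f' y = f y"
proof -
  have "((\<lambda>t. t *\<^sub>R y) has_derivative (\<lambda>h. h *\<^sub>R y)) (at (1::real))"
    by (auto intro!: derivative_eq_intros)
  from has_derivative_compose[OF this, of f f'] f
  have 1: "((\<lambda>t. f (t *\<^sub>R y)) has_derivative (\<lambda>h. f' (h *\<^sub>R y))) (at 1)"
    by simp
  have "((\<lambda>t. t * f y) has_derivative (\<lambda>h. h * f y)) (at (1::real))"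
    by (auto intro!: derivative_eq_intros)
  then have 2: "((\<lambda>t. f (t *\<^sub>R y)) has_derivative (\<lambda>h. h * f y)) (at 1)"
    by (rule has_derivative_transform_within_open[of _ _ _ _ "{0<..}"]) (auto simp: hom)
  show ?thesis
    using fun_cong[OF has_derivative_unique[OF 1 2], of 1] by simp
qed

lemma homogeneous_derivative:
  fixes f :: "'a::real_normed_vector \<Rightarrow> real"
  assumes hom: "\<And>y. f (t *\<^sub>R y) = t * f y" and "t > 0"
    and f: "(f has_derivative f') (at y)" and f2: "(f has_derivative f2) (at (t *\<^sub>R y))"
  shows "f2 = f'"
proof -
  have "((\<lambda>y. t *\<^sub>R y) has_derivative (\<lambda>h. t *\<^sub>R h)) (at y)"
    by (auto intro!: derivative_eq_intros)
  from has_derivative_compose[OF this f2]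
  have 1: "((\<lambda>y. t * f y) has_derivative (\<lambda>h. f2 (t *\<^sub>R h))) (at y)"
    by (simp add: hom)
  have 2: "((\<lambda>y. t * f y) has_derivative (\<lambda>h. t * f' h)) (at y)"
    using f by (auto intro!: derivative_eq_intros)
  have "linear f2" using f2 has_derivative_linear by blast
  then have "t * f2 h = t * f' h" for h
    using fun_cong[OF has_derivative_unique[OF 1 2], of h] by (simp add: linear_cmul)
  with \<open>t > 0\<close> show ?thesis by auto
qed

text \<open>For L = F^2 one has L_{x^m y^l} y^m - L_{x^l} = 2 F_{y^l} F_{x^m} y^m + 2 F (F_{x^m y^l}
  y^m - F_{x^l}). Since g_{li} y^i = F F_{y^l}, the factor P = F_{x^m} y^m / (2F) makes 4 P g y
  equal to the first summand, and Hamel's expression is what remains. \<open>Fxy\<close>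
  differentiates in x before y, the order used in \<open>geodesic_coeff\<close>.\<close>

lemma hamel:
  fixes F :: "real^'n \<Rightarrow> real^'n \<Rightarrow> real"
  assumes y: "y \<noteq> 0" and pos: "F x y > 0"
    and hom: "\<And>t y'. t > 0 \<Longrightarrow> F x (t *\<^sub>R y') = t * F x y'"
    and pd: "\<And>v. v \<noteq> 0 \<Longrightarrow> v \<bullet> (fundamental_tensor F x y *v v) > 0"
    and Fx: "\<And>y'. y' \<noteq> 0 \<Longrightarrow> ((\<lambda>x'. F x' y') has_derivative Fx y') (at x)"
    and Fxy: "\<And>z. ((\<lambda>y'. Fx y' z) has_derivative Fxy z) (at y)"
    and Fy: "\<And>y'. y' \<noteq> 0 \<Longrightarrow> (F x has_derivative Fy y') (at y')"
    and Fyy: "\<And>z. (\<lambda>y'. Fy y' z) differentiable (at y)"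
  shows "geodesic_coeff F x y = (Fx y y / (2 * F x y)) *\<^sub>R y \<longleftrightarrow> (\<forall>z. Fxy y z = Fx y z)"
    and "(\<Sum>k\<in>UNIV. partial k (\<lambda>x'. F x' y) x * y $ k) = Fx y y"
proof -
  define e :: "'n \<Rightarrow> real^'n" where "e i = axis i 1" for i
  define g where "g = fundamental_tensor F x y"
  have ndiff: "open (- {0 :: real^'n})" by (simp add: open_Compl)
  have lin_Fx: "linear (Fx y')" if "y' \<noteq> 0" for y'
    using Fx[OF that] has_derivative_linear by blast
  have lin_Fxy: "linear (Fxy z)" for z
    using Fxy has_derivative_linear by blast
  show Fx_y: "(\<Sum>k\<in>UNIV. partial k (\<lambda>x'. F x' y) x * y $ k) = Fx y y"
    using linear_sum_axis[OF lin_Fx[OF y]] by (simp add: partial_eq[OF Fx[OF y]])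

  have dxL: "partial m (\<lambda>x'. (F x' y')\<^sup>2) x = 2 * F x y' * Fx y' (e m)" if "y' \<noteq> 0" for m y'
    unfolding e_def
    by (rule partial_eq[of _ "\<lambda>h. 2 * F x y' * Fx y' h"])
      (auto intro!: derivative_eq_intros Fx that)
  have dyL: "partial i (\<lambda>y'. (F x y')\<^sup>2) y' = 2 * F x y' * Fy y' (e i)" if "y' \<noteq> 0" for i y'
    unfolding e_def
    by (rule partial_eq[of _ "\<lambda>h. 2 * F x y' * Fy y' h"])
      (auto intro!: derivative_eq_intros Fy that)

  \<comment> \<open>\<open>Fxy\<close> is not assumed linear in its first argument. The linearity
    needed here is inherited from \<open>Fx y'\<close> for nonzero \<open>y'\<close>, by uniqueness
    of derivatives.\<close>
  have Fxy_sum: "(\<Sum>m\<in>UNIV. y $ m * Fxy (e m) z) = Fxy y z" for z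
  proof -
    have "((\<lambda>y'. \<Sum>m\<in>UNIV. y $ m * Fx y' (e m)) has_derivative
        (\<lambda>z. \<Sum>m\<in>UNIV. y $ m * Fxy (e m) z)) (at y)"
      by (auto intro!: derivative_eq_intros Fxy)
    then have "((\<lambda>y'. Fx y' y) has_derivative (\<lambda>z. \<Sum>m\<in>UNIV. y $ m * Fxy (e m) z)) (at y)"
      by (rule has_derivative_transform_within_open[OF _ ndiff])
        (use y linear_sum_axis[OF lin_Fx, of _ y] in \<open>auto simp: e_def mult.commute\<close>)
    from has_derivative_unique[OF this Fxy] show ?thesis
      by metis
  qed
  have dyxL: "partial l (\<lambda>y'. partial m (\<lambda>x'. (F x' y')\<^sup>2) x) y
      = 2 * Fy y (e l) * Fx y (e m) + 2 * F x y * Fxy (e m) (e l)" for l m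
  proof -
    have "((\<lambda>y'. 2 * F x y' * Fx y' (e m)) has_derivative
        (\<lambda>h. 2 * Fy y h * Fx y (e m) + 2 * F x y * Fxy (e m) h)) (at y)"
      by (auto intro!: derivative_eq_intros Fxy Fy y)
    then have "((\<lambda>y'. partial m (\<lambda>x'. (F x' y')\<^sup>2) x) has_derivative
        (\<lambda>h. 2 * Fy y h * Fx y (e m) + 2 * F x y * Fxy (e m) h)) (at y)"
      by (rule has_derivative_transform_within_open[OF _ ndiff]) (use y dxL in auto)
    from partial_eq[OF this] show ?thesis by (simp add: e_def)
  qed
  define W :: "real^'n" where "W = (\<chi> l. (\<Sum>m\<in>UNIV. partial l (\<lambda>y'. partial m (\<lambda>x'. (F x' y')\<^sup>2) x) y * y $ m)
        - partial l (\<lambda>x'. (F x' y)\<^sup>2) x)"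
  have W: "W $ l = 2 * Fy y (e l) * Fx y y + 2 * F x y * (Fxy y (e l) - Fx y (e l))" for l
  proof -
    have "(\<Sum>m\<in>UNIV. partial l (\<lambda>y'. partial m (\<lambda>x'. (F x' y')\<^sup>2) x) y * y $ m)
        = 2 * Fy y (e l) * (\<Sum>m\<in>UNIV. Fx y (e m) * y $ m)
          + 2 * F x y * (\<Sum>m\<in>UNIV. y $ m * Fxy (e m) (e l))"
      unfolding dyxL by (simp add: algebra_simps sum.distrib sum_distrib_left)
    also have "\<dots> = 2 * Fy y (e l) * Fx y y + 2 * F x y * Fxy y (e l)"
      using linear_sum_axis[OF lin_Fx[OF y], of y] Fxy_sum by (simp add: e_def)
    finally show ?thesis
      by (simp add: W_def dxL[OF y] algebra_simps)
  qed

  \<comment> \<open>\<open>K\<close> is the i-th y-derivative of F^2. It is homogeneous of degree 1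
    along the ray of y, because \<open>Fy\<close> is of degree 0, so Euler's relation evaluates its
    derivative in the direction y.\<close>
  have "(g *v y) $ i = F x y * Fy y (e i)" for i
  proof -
    define K where "K y' = 2 * F x y' * Fy y' (e i)" for y'
    obtain F2 where F2: "((\<lambda>y'. Fy y' (e i)) has_derivative F2) (at y)"
      using Fyy by (auto simp: differentiable_def)
    have K': "(K has_derivative (\<lambda>h. 2 * Fy y h * Fy y (e i) + 2 * F x y * F2 h)) (at y)"
      unfolding K_def by (auto intro!: derivative_eq_intros F2 Fy y)
    define K' where "K' = (\<lambda>h. 2 * Fy y h * Fy y (e i) + 2 * F x y * F2 h)"
    note K' = K'[folded K'_def]
    have "Fy (t *\<^sub>R y) = Fy y" if "t > 0" for t
      using homogeneous_derivative[OF hom[OF that] that Fy[OF y] Fy[of "t *\<^sub>R y"]] y that by simp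
    then have "K' y = K y"
      by (intro homogeneous_euler[OF K']) (simp add: K_def hom)
    moreover have "((\<lambda>y'. partial i (\<lambda>y''. (F x y'')\<^sup>2) y') has_derivative K') (at y)"
      using K' by (rule has_derivative_transform_within_open[OF _ ndiff]) (use y dyL K_def in auto)
    then have "g $ i $ j = 1/2 * K' (e j)" for j
      by (simp add: g_def fundamental_tensor_def partial_eq e_def)
    then have "(g *v y) $ i = (\<Sum>j\<in>UNIV. 1/2 * K' (e j) * y $ j)"
      by (simp only: matrix_vector_mult_def vec_lambda_beta)
    then have "(g *v y) $ i = 1/2 * (\<Sum>j\<in>UNIV. K' (e j) * y $ j)"
      by (simp only: sum_distrib_left mult.assoc)
    ultimately show ?thesis
      using linear_sum_axis[OF has_derivative_linear[OF K'], of y] by (simp add: e_def K_def)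
  qed
  note gy = this

  have inv: "invertible g"
    by (rule posdef_imp_invertible) (use pd g_def in auto)
  have G: "geodesic_coeff F x y = (1/4) *\<^sub>R (matrix_inv g *v W)"
    by (simp add: geodesic_coeff_def vec_eq_iff matrix_vector_mult_def W_def g_def)
  define P where "P = Fx y y / (2 * F x y)"
  have "geodesic_coeff F x y = P *\<^sub>R y \<longleftrightarrow> W = (4 * P) *\<^sub>R (g *v y)"
  proof
    assume "geodesic_coeff F x y = P *\<^sub>R y"
    then have "g *v ((1/4) *\<^sub>R (matrix_inv g *v W)) = g *v (P *\<^sub>R y)"
      by (simp add: G)
    then have "(1/4) *\<^sub>R W = P *\<^sub>R (g *v y)"
      by (simp add: matrix_vector_mult_scaleR matrix_inv_vector[OF inv])
    then have "4 *\<^sub>R ((1/4) *\<^sub>R W) = 4 *\<^sub>R (P *\<^sub>R (g *v y))" by simp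
    then show "W = (4 * P) *\<^sub>R (g *v y)" by simp
  next
    assume "W = (4 * P) *\<^sub>R (g *v y)"
    then show "geodesic_coeff F x y = P *\<^sub>R y"
      by (simp add: G matrix_vector_mult_scaleR matrix_inv_vector[OF inv])
  qed
  also have "\<dots> \<longleftrightarrow> (\<forall>l. Fxy y (e l) = Fx y (e l))"
    using pos by (auto simp: vec_eq_iff W gy P_def)
  also have "\<dots> \<longleftrightarrow> (\<forall>z. Fxy y z = Fx y z)"
    using linear_eq_axis[OF lin_Fxy lin_Fx[OF y]] unfolding e_def by blast
  finally show "geodesic_coeff F x y = (Fx y y / (2 * F x y)) *\<^sub>R y \<longleftrightarrow> (\<forall>z. Fxy y z = Fx y z)"
    unfolding P_def .
qed


section \<open>The covariant derivative of a 1-form\<close>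

lemma symmetric_matrix_inner:
  fixes A :: "real^'n^'n"
  assumes "transpose A = A"
  shows "v \<bullet> (A *v w) = w \<bullet> (A *v v)"
  by (metis assms dot_lmul_matrix inner_commute transpose_matrix_vector)

lemma scaleR_matrix_vector: "(r *\<^sub>R A) *v v = r *\<^sub>R (A *v v)" for A :: "real^'n^'m"
  by (simp add: vec_eq_iff matrix_vector_mult_def sum_distrib_left mult.assoc)

lemma bounded_bilinear_matrix_vector: "bounded_bilinear ((*v) :: real^'n^'m \<Rightarrow> _)"
  unfolding bilinear_conv_bounded_bilinear[symmetric] bilinear_def
  by (auto intro!: linearI simp: matrix_vector_right_distrib matrix_vector_mult_add_rdistrib
      matrix_vector_mult_scaleR scaleR_matrix_vector)

lemma differentiable_prod:
  fixes f :: "'i \<Rightarrow> 'a::real_normed_vector \<Rightarrow> real"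
  assumes "\<And>i. i \<in> I \<Longrightarrow> f i differentiable (at x)"
  shows "(\<lambda>x. \<Prod>i\<in>I. f i x) differentiable (at x)"
proof -
  obtain f' where "\<And>i. i \<in> I \<Longrightarrow> (f i has_derivative f' i) (at x)"
    using assms unfolding differentiable_def by metis
  then show ?thesis
    unfolding differentiable_def by (blast intro: has_derivative_prod)
qed

lemma differentiable_det:
  fixes A :: "'a::real_normed_vector \<Rightarrow> real^'n^'n"
  assumes "\<And>i j. (\<lambda>x. A x $ i $ j) differentiable (at x)"
  shows "(\<lambda>x. det (A x)) differentiable (at x)"
  unfolding det_def
  by (intro differentiable_sum ballI differentiable_mult differentiable_prod differentiable_const assms)
    (simp add: finite_permutations)

lemma differentiable_vec_lambda:
  fixes f :: "'i::finite \<Rightarrow> 'a::real_normed_vector \<Rightarrow> real"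
  assumes "\<And>i. f i differentiable (at x)"
  shows "(\<lambda>x. \<chi> i. f i x) differentiable (at x)"
proof -
  obtain f' where "\<And>i. (f i has_derivative f' i) (at x)"
    using assms unfolding differentiable_def by metis
  then have "((\<lambda>x. \<chi> i. f i x) has_derivative (\<lambda>h. \<chi> i. f' i h)) (at x)"
    by (auto simp: has_derivative_componentwise_within[of "\<lambda>x. \<chi> i. f i x"] Basis_vec_def inner_axis)
  then show ?thesis by (auto simp: differentiable_def)
qed

lemma differentiable_vec_nth:
  "f differentiable (at x) \<Longrightarrow> (\<lambda>x. f x $ i) differentiable (at x)"
  unfolding differentiable_def using bounded_linear.has_derivative[OF bounded_linear_vec_nth] by blast

locale riemannian_form =
  fixes U :: "(real^'n) set" and a :: "real^'n \<Rightarrow> real^'n^'n" and b :: "real^'n \<Rightarrow> real^'n"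
  assumes U: "open U" and riem: "riemannian_metric U a" and form: "smooth_on U b"
begin

abbreviation "Da x v \<equiv> frechet_derivative a (at x) v"
abbreviation "Db x v \<equiv> frechet_derivative b (at x) v"

definition B where "B x = matrix_inv (a x) *v b x"

text \<open>\<open>C x v w\<close> is \<open>b\<^bsub>i|j\<^esub> v\<^sup>i w\<^sup>j\<close> (\<open>cov_deriv_eq\<close>); the Christoffel symbols enter only
  contracted with \<open>b\<close>, hence through the vector \<open>B\<close> dual to \<open>b\<close>.\<close>

definition C where
  "C x v w = v \<bullet> Db x w
    - (w \<bullet> (Da x v *v B x) + v \<bullet> (Da x w *v B x) - v \<bullet> (Da x (B x) *v w)) / 2"

lemma a_has_derivative: "x \<in> U \<Longrightarrow> (a has_derivative Da x) (at x)"
  using riem by (auto simp: riemannian_metric_def intro: smooth_on_has_derivative)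

lemma b_has_derivative: "x \<in> U \<Longrightarrow> (b has_derivative Db x) (at x)"
  using form by (rule smooth_on_has_derivative)

lemma linear_Da: "x \<in> U \<Longrightarrow> linear (Da x)"
  using a_has_derivative has_derivative_linear by blast

lemma linear_Db: "x \<in> U \<Longrightarrow> linear (Db x)"
  using b_has_derivative has_derivative_linear by blast

lemma a_pos: "x \<in> U \<Longrightarrow> v \<noteq> 0 \<Longrightarrow> v \<bullet> (a x *v v) > 0"
  using riem by (auto simp: riemannian_metric_def)

lemma a_nonneg: "x \<in> U \<Longrightarrow> v \<bullet> (a x *v v) \<ge> 0"
  using a_pos[of x v] by (cases "v = 0") auto

lemma a_sym: "x \<in> U \<Longrightarrow> v \<bullet> (a x *v w) = w \<bullet> (a x *v v)"
  using riem by (auto simp: riemannian_metric_def intro: symmetric_matrix_inner)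

lemma a_invertible: "x \<in> U \<Longrightarrow> invertible (a x)"
  by (rule posdef_imp_invertible) (rule a_pos)

lemma a_B: "x \<in> U \<Longrightarrow> a x *v B x = b x"
  unfolding B_def by (intro matrix_inv_vector a_invertible)

lemma inner_a_B: "x \<in> U \<Longrightarrow> B x \<bullet> (a x *v v) = b x \<bullet> v"
  using a_B[of x] a_sym[of x] by (metis inner_commute)

lemma bsq_eq: "bsq a b x = b x \<bullet> B x"
  by (simp add: bsq_def B_def)

lemma bsq_eq_norm: "x \<in> U \<Longrightarrow> bsq a b x = B x \<bullet> (a x *v B x)"
  by (simp add: bsq_eq inner_a_B)

lemma B_eq_0_iff: "x \<in> U \<Longrightarrow> B x = 0 \<longleftrightarrow> b x = 0"
  using a_B[of x] by (auto simp: B_def)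

lemma bsq_pos: "x \<in> U \<Longrightarrow> b x \<noteq> 0 \<Longrightarrow> bsq a b x > 0"
  by (simp add: bsq_eq_norm a_pos B_eq_0_iff)

lemma bsq_nonneg: "x \<in> U \<Longrightarrow> bsq a b x \<ge> 0"
  by (simp add: bsq_eq_norm a_nonneg)

text \<open>Nonnegativity of the squared length of b^2 y - beta(y) B, which is b^2 times the
  component of y perpendicular to beta. It confines s = beta/alpha to s^2 \<le> b^2, so that the
  arguments of phi lie in \<open>phi_domain\<close>.\<close>

lemma cauchy_schwarz:
  assumes x: "x \<in> U"
  shows "(b x \<bullet> y)\<^sup>2 \<le> bsq a b x * (y \<bullet> (a x *v y))"
proof (cases "b x = 0")
  case False
  define u where "u = bsq a b x"
  have u: "u > 0" using bsq_pos[OF x False] by (simp add: u_def)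
  define v where "v = u *\<^sub>R y - (b x \<bullet> y) *\<^sub>R B x"
  have "v \<bullet> (a x *v v) = u * u * (y \<bullet> (a x *v y)) - u * (b x \<bullet> y) * (y \<bullet> (a x *v B x))
      - u * (b x \<bullet> y) * (B x \<bullet> (a x *v y)) + (b x \<bullet> y)\<^sup>2 * (B x \<bullet> (a x *v B x))"
    unfolding v_def
    by (simp add: matrix_vector_mult_diff_distrib matrix_vector_mult_scaleR inner_diff_left
        inner_diff_right algebra_simps power2_eq_square)
  also have "\<dots> = u * (u * (y \<bullet> (a x *v y)) - (b x \<bullet> y)\<^sup>2)"
    using x by (simp add: a_B inner_a_B bsq_eq[symmetric] u_def[symmetric] inner_commute[of y]
        inner_commute[of "B x" "b x"] algebra_simps power2_eq_square)
  finally show ?thesis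
    using a_nonneg[OF x, of v] u by (simp add: u_def[symmetric] zero_le_mult_iff)
qed (use x in \<open>simp add: bsq_eq\<close>)

lemma inner_a_has_derivative:
  "x \<in> U \<Longrightarrow> ((\<lambda>x. v \<bullet> (a x *v w)) has_derivative (\<lambda>h. v \<bullet> (Da x h *v w))) (at x)"
  by (intro bounded_linear.has_derivative[OF bounded_linear_inner_right]
      bounded_linear.has_derivative[OF
        bounded_bilinear.bounded_linear_left[OF bounded_bilinear_matrix_vector]] a_has_derivative)

lemma Da_sym:
  assumes "x \<in> U"
  shows "v \<bullet> (Da x h *v w) = w \<bullet> (Da x h *v v)"
proof -
  have "((\<lambda>x. v \<bullet> (a x *v w)) has_derivative (\<lambda>h. w \<bullet> (Da x h *v v))) (at x)"
    using inner_a_has_derivative[OF assms, of w v] U assms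
    by (rule has_derivative_transform_within_open) (rule a_sym)
  from has_derivative_unique[OF this inner_a_has_derivative[OF assms]] show ?thesis
    by metis
qed

text \<open>Cramer's rule writes the components as quotients of determinants, hence of polynomials
  in the entries of a and b, and no derivative of the matrix inverse is required.\<close>

lemma B_differentiable:
  assumes "x \<in> U"
  shows "B differentiable (at x)"
proof -
  define M where "M k y = (\<chi> i j. if j = k then b y $ i else a y $ i $ j)" for k y
  have da: "(\<lambda>y. a y $ i $ j) differentiable (at x)" for i j
    using a_has_derivative[OF assms] by (intro differentiable_vec_nth) (auto simp: differentiable_def)
  have db: "(\<lambda>y. b y $ i) differentiable (at x)" for i
    using b_has_derivative[OF assms] by (intro differentiable_vec_nth) (auto simp: differentiable_def)
  have nz: "det (a y) \<noteq> 0" if "y \<in> U" for y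
    using a_invertible[OF that] by (simp add: invertible_det_nz)
  have "(\<lambda>y. M k y $ i $ j) differentiable (at x)" for k i j
    using da db by (cases "j = k") (simp_all add: M_def)
  then have "(\<lambda>y. \<chi> k. det (M k y) / det (a y)) differentiable (at x)"
    using nz[OF assms] da
    by (intro differentiable_vec_lambda differentiable_divide differentiable_det) auto
  moreover have "B y = (\<chi> k. det (M k y) / det (a y))" if "y \<in> U" for y
    using cramer[OF nz[OF that], of "B y" "b y"] a_B[OF that] unfolding M_def by simp
  ultimately show ?thesis
    unfolding differentiable_def
    by (blast intro: has_derivative_transform_within_open[OF _ U assms, of "\<lambda>y. \<chi> k. det (M k y) / det (a y)"]
        dest: sym)
qed

text \<open>Differentiating a B = b eliminates the derivative of B. In \<open>C x (B x) h\<close>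
  two of the three metric terms cancel by the symmetry of \<open>Da\<close>, and the third is the
  one this elimination leaves.\<close>

lemma bsq_has_derivative:
  assumes x: "x \<in> U"
  shows "(bsq a b has_derivative (\<lambda>h. 2 * C x (B x) h)) (at x)"
proof -
  obtain B' where B': "(B has_derivative B') (at x)"
    using B_differentiable[OF x] by (auto simp: differentiable_def)
  have 1: "(bsq a b has_derivative (\<lambda>h. b x \<bullet> B' h + Db x h \<bullet> B x)) (at x)"
    unfolding bsq_eq[abs_def] by (intro has_derivative_inner b_has_derivative B' x)
  have "(b has_derivative (\<lambda>h. a x *v B' h + Da x h *v B x)) (at x)"
    using bounded_bilinear.FDERIV[OF bounded_bilinear_matrix_vector a_has_derivative[OF x] B'] U x
    by (rule has_derivative_transform_within_open) (rule a_B)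
  from fun_cong[OF has_derivative_unique[OF this b_has_derivative[OF x]]]
  have "B x \<bullet> (a x *v B' h) = B x \<bullet> (Db x h - Da x h *v B x)" for h
    by (simp add: inner_add_right flip: \<open>\<And>h. a x *v B' h + Da x h *v B x = Db x h\<close>)
  then have "b x \<bullet> B' h + Db x h \<bullet> B x = 2 * C x (B x) h" for h
    using Da_sym[OF x, of "B x" "B x" h]
    by (simp add: inner_a_B x C_def inner_diff_right inner_commute algebra_simps)
  with 1 show ?thesis by simp
qed

lemma C_add_left: "x \<in> U \<Longrightarrow> C x (v + v') w = C x v w + C x v' w"
  by (simp add: C_def linear_add[OF linear_Da] matrix_vector_right_distrib
      matrix_vector_mult_add_rdistrib inner_add_left inner_add_right field_simps)

lemma C_add_right: "x \<in> U \<Longrightarrow> C x v (w + w') = C x v w + C x v w'"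
  by (simp add: C_def linear_add[OF linear_Da] linear_add[OF linear_Db] matrix_vector_right_distrib
      matrix_vector_mult_add_rdistrib inner_add_left inner_add_right field_simps)

lemma C_scaleR_left: "x \<in> U \<Longrightarrow> C x (r *\<^sub>R v) w = r * C x v w"
  by (simp add: C_def linear_cmul[OF linear_Da] scaleR_matrix_vector field_simps)

lemma C_scaleR_right: "x \<in> U \<Longrightarrow> C x v (r *\<^sub>R w) = r * C x v w"
  by (simp add: C_def linear_cmul[OF linear_Da] linear_cmul[OF linear_Db] scaleR_matrix_vector
      matrix_vector_mult_scaleR field_simps)

lemma bilinear_C: "x \<in> U \<Longrightarrow> bilinear (C x)"
  unfolding bilinear_def
  by (auto intro!: linearI simp: C_add_left C_add_right C_scaleR_left C_scaleR_right)

text \<open>The Christoffel terms are symmetric in the two arguments and drop out of the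
  antisymmetric part, which is therefore the exterior derivative of beta.\<close>

lemma C_curl: "x \<in> U \<Longrightarrow> C x z y - C x y z = z \<bullet> Db x y - y \<bullet> Db x z"
  using Da_sym[of x y "B x" z] by (simp add: C_def field_simps)

lemma matrix_inv_sym:
  assumes "x \<in> U"
  shows "matrix_inv (a x) $ k $ l = matrix_inv (a x) $ l $ k"
proof -
  let ?A = "a x" and ?I = "matrix_inv (a x)"
  have "transpose ?A = ?A" using riem assms by (auto simp: riemannian_metric_def)
  then have "transpose ?I ** ?A = mat 1"
    using matrix_inv_works[OF a_invertible[OF assms]]
    by (metis matrix_transpose_mul transpose_mat)
  then have "(transpose ?I ** ?A) ** ?I = ?I"
    by simp
  then have "transpose ?I = ?I"
    by (simp add: matrix_inv_works[OF a_invertible[OF assms]] flip: matrix_mul_assoc)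
  then have "?I $ k $ l = transpose ?I $ k $ l" by simp
  also have "\<dots> = ?I $ l $ k" by (simp add: transpose_def)
  finally show ?thesis .
qed

lemma cov_deriv_eq:
  assumes x: "x \<in> U"
  shows "cov_deriv a b x i j = C x (axis i 1) (axis j 1)"
proof -
  define e :: "'n \<Rightarrow> real^'n" where "e i = axis i 1" for i
  have nth: "e i \<bullet> v = v $ i" for i v
    by (simp add: e_def inner_axis')
  have pa: "partial m (\<lambda>x'. a x' $ i $ j) x = Da x (e m) $ i $ j" for m i j
    unfolding e_def
    by (rule partial_eq[of _ "\<lambda>h. Da x h $ i $ j"])
      (intro bounded_linear.has_derivative[OF bounded_linear_vec_nth] a_has_derivative x)
  have pb: "partial j (\<lambda>x'. b x' $ i) x = Db x (e j) $ i"
    unfolding e_def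
    by (rule partial_eq[of _ "\<lambda>h. Db x h $ i"])
      (intro bounded_linear.has_derivative[OF bounded_linear_vec_nth] b_has_derivative x)
  define T where "T l = Da x (e i) $ j $ l + Da x (e j) $ i $ l - Da x (e l) $ i $ j" for l
  \<comment> \<open>Symmetry of the inverse matrix moves k to the column index, so that summing
    against b over k produces B.\<close>
  have chr: "christoffel a x k i j = 1/2 * (\<Sum>l\<in>UNIV. matrix_inv (a x) $ l $ k * T l)" for k
    by (simp only: christoffel_def pa T_def matrix_inv_sym[OF x, of k])
  have "(\<Sum>k\<in>UNIV. christoffel a x k i j * b x $ k)
      = (\<Sum>k\<in>UNIV. \<Sum>l\<in>UNIV. 1/2 * matrix_inv (a x) $ l $ k * T l * b x $ k)"
    by (simp add: chr sum_distrib_left sum_distrib_right mult.assoc)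
  also have "\<dots> = (\<Sum>l\<in>UNIV. \<Sum>k\<in>UNIV. 1/2 * matrix_inv (a x) $ l $ k * T l * b x $ k)"
    by (rule sum.swap)
  also have "\<dots> = 1/2 * (\<Sum>l\<in>UNIV. T l * B x $ l)"
    by (simp add: B_def matrix_vector_mult_def sum_distrib_left mult_ac)
  also have "(\<Sum>l\<in>UNIV. T l * B x $ l) = (Da x (e i) *v B x) $ j + (Da x (e j) *v B x) $ i
      - (\<Sum>l\<in>UNIV. Da x (e l) $ i $ j * B x $ l)"
    by (simp add: T_def matrix_vector_mult_def sum.distrib sum_subtractf algebra_simps)
  also have "(\<Sum>l\<in>UNIV. Da x (e l) $ i $ j * B x $ l) = Da x (B x) $ i $ j"
  proof -
    have "linear (\<lambda>v. Da x v $ i $ j)"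
      using linear_Da[OF x] by (auto intro!: linearI simp: linear_add linear_cmul)
    from linear_sum_axis[OF this] show ?thesis by (simp add: e_def)
  qed
  also have "Da x (B x) $ i $ j = e i \<bullet> (Da x (B x) *v e j)"
    by (simp add: inner_axis' e_def matrix_vector_mult_basis column_def)
  finally show ?thesis
    by (simp add: cov_deriv_def pb C_def nth flip: e_def)
qed

end


section \<open>Derivatives of the metrics\<close>

context riemannian_form
begin

text \<open>\<open>ax\<close> and \<open>ay\<close> are the derivatives of \<open>\<alpha>\<close> in \<open>x\<close> and in \<open>y\<close>, \<open>axy\<close> is the mixed one;
  below, \<open>sy\<close>, \<open>Fx\<close>, \<open>Fy\<close> and \<open>Fxy\<close> are named in the same way.\<close>

definition "ax x y h = (y \<bullet> (Da x h *v y)) / (2 * alpha a x y)"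
definition "ay x y h = (y \<bullet> (a x *v h)) / alpha a x y"
definition "axy x y z h = (y \<bullet> (Da x z *v h)) / alpha a x y
    - (y \<bullet> (Da x z *v y)) * (y \<bullet> (a x *v h)) / (2 * alpha a x y ^ 3)"

lemma alpha_sq: "x \<in> U \<Longrightarrow> (alpha a x y)\<^sup>2 = y \<bullet> (a x *v y)"
  by (simp add: alpha_def a_nonneg)

lemma alpha_pos: "x \<in> U \<Longrightarrow> y \<noteq> 0 \<Longrightarrow> alpha a x y > 0"
  by (simp add: alpha_def a_pos)

lemma alpha_scaleR: "t > 0 \<Longrightarrow> alpha a x (t *\<^sub>R y) = t * alpha a x y"
  by (simp add: alpha_def matrix_vector_mult_scaleR real_sqrt_mult flip: mult.assoc power2_eq_square)

lemma alpha_has_derivative_x: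
  assumes "x \<in> U" "y \<noteq> 0"
  shows "((\<lambda>x. alpha a x y) has_derivative ax x y) (at x)"
  unfolding alpha_def
  by (rule has_derivative_eq_rhs[OF DERIV_compose_FDERIV[OF
        DERIV_real_sqrt[OF a_pos[OF assms]] inner_a_has_derivative[OF assms(1)]]])
    (simp add: ax_def alpha_def fun_eq_iff field_simps)

lemma matrix_vector_has_derivative:
  "((\<lambda>y. (A :: real^'n^'n) *v y) has_derivative (\<lambda>h. A *v h)) (at y)"
  by (rule bounded_linear_imp_has_derivative)
    (rule bounded_bilinear.bounded_linear_right[OF bounded_bilinear_matrix_vector])

lemma a_quad_has_derivative:
  assumes "x \<in> U"
  shows "((\<lambda>y. y \<bullet> (a x *v y)) has_derivative (\<lambda>h. 2 * (y \<bullet> (a x *v h)))) (at y)"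
  using a_sym[OF assms, of y]
  by (auto intro!: derivative_eq_intros matrix_vector_has_derivative)

lemma Da_quad_has_derivative:
  assumes "x \<in> U"
  shows "((\<lambda>y. y \<bullet> (Da x z *v y)) has_derivative (\<lambda>h. 2 * (y \<bullet> (Da x z *v h)))) (at y)"
  using Da_sym[OF assms, of y z]
  by (auto intro!: derivative_eq_intros matrix_vector_has_derivative)

lemma alpha_has_derivative_y:
  assumes "x \<in> U" "y \<noteq> 0"
  shows "(alpha a x has_derivative ay x y) (at y)"
  unfolding alpha_def[abs_def]
  by (rule has_derivative_eq_rhs[OF DERIV_compose_FDERIV[OF
        DERIV_real_sqrt[OF a_pos[OF assms]] a_quad_has_derivative[OF assms(1)]]])
    (simp add: ay_def alpha_def fun_eq_iff field_simps)

lemma ax_has_derivative_y: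
  assumes "x \<in> U" "y \<noteq> 0"
  shows "((\<lambda>y. ax x y z) has_derivative axy x y z) (at y)"
proof -
  have "((\<lambda>y. 2 * alpha a x y) has_derivative (\<lambda>h. 2 * ay x y h)) (at y)"
    by (intro has_derivative_mult_right alpha_has_derivative_y assms)
  from has_derivative_divide[OF Da_quad_has_derivative[OF assms(1), of z y] this]
  show ?thesis
    unfolding ax_def
    by (rule has_derivative_eq_rhs)
      (use alpha_pos[OF assms] in \<open>simp_all add: axy_def ay_def fun_eq_iff field_simps power3_eq_cube\<close>)
qed

lemma ay_differentiable:
  assumes "x \<in> U" "y \<noteq> 0"
  shows "(\<lambda>y. ay x y z) differentiable (at y)"
  unfolding ay_def
  using alpha_pos[OF assms] alpha_has_derivative_y[OF assms]
  by (intro differentiable_divide) (auto simp: differentiable_def intro!: derivative_eq_intros exI)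

lemma fundamental_tensor_alpha:
  assumes x: "x \<in> U"
  shows "fundamental_tensor (alpha a) x y = a x"
proof -
  have "partial i (\<lambda>y. (alpha a x y)\<^sup>2) y = 2 * (y \<bullet> (a x *v axis i 1))" for i y
    unfolding alpha_sq[OF x] by (rule partial_eq) (rule a_quad_has_derivative[OF x])
  moreover have "partial j (\<lambda>y. 2 * (y \<bullet> (a x *v axis i 1))) y = 2 * (axis j 1 \<bullet> (a x *v axis i 1))" for i j y
    by (rule partial_eq) (auto intro!: derivative_eq_intros)
  moreover have "axis j 1 \<bullet> (a x *v axis i 1) = a x $ i $ j" for i j
    using a_sym[OF x, of "axis j 1" "axis i 1"]
    by (simp add: inner_axis' matrix_vector_mult_basis column_def)
  ultimately show ?thesis
    by (simp add: fundamental_tensor_def vec_eq_iff)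
qed

lemma alpha_hamel:
  assumes x: "x \<in> U" and y: "y \<noteq> 0"
  shows "geodesic_coeff (alpha a) x y = (ax x y y / (2 * alpha a x y)) *\<^sub>R y
      \<longleftrightarrow> (\<forall>z. axy x y y z = ax x y z)"
    and "(\<Sum>k\<in>UNIV. partial k (\<lambda>x'. alpha a x' y) x * y $ k) = ax x y y"
  by (rule hamel[of y "alpha a" x "ax x" "axy x y" "ay x"];
      simp add: x y alpha_pos alpha_scaleR fundamental_tensor_alpha a_pos
        alpha_has_derivative_x ax_has_derivative_y alpha_has_derivative_y ay_differentiable)+

text \<open>The geodesic coefficients of alpha are P y with P = alpha_{x^k} y^k / (2 alpha), so the
  Christoffel term of b_{i|j} y^i y^j is 2 P beta, that is s alpha_{x^k} y^k. The proof obtains this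
  from Hamel's equation for alpha tested on the vector B.\<close>

lemma alpha_flat_imp:
  assumes flat: "projectively_flat U (alpha a)" and x: "x \<in> U" and y: "y \<noteq> 0"
  shows "geodesic_coeff (alpha a) x y = (ax x y y / (2 * alpha a x y)) *\<^sub>R y"
    and "axy x y y z = ax x y z"
    and "C x y y = y \<bullet> Db x y - (b x \<bullet> y / alpha a x y) * ax x y y"
proof -
  show G: "geodesic_coeff (alpha a) x y = (ax x y y / (2 * alpha a x y)) *\<^sub>R y"
    using flat x y alpha_hamel(2)[OF x y] by (simp add: projectively_flat_def)
  then have H: "axy x y y z = ax x y z" for z
    using alpha_hamel(1)[OF x y] by simp
  then show "axy x y y z = ax x y z" .
  have pos: "alpha a x y > 0" using alpha_pos x y .
  have "y \<bullet> (a x *v B x) = b x \<bullet> y"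
    using a_sym[OF x] inner_a_B[OF x] by metis
  with pos have "y \<bullet> (Da x y *v B x) - (y \<bullet> (Da x (B x) *v y)) / 2
      = alpha a x y * (axy x y y (B x) - ax x y (B x))
        + (y \<bullet> (Da x y *v y)) * (b x \<bullet> y) / (2 * (alpha a x y)\<^sup>2)"
    by (simp add: axy_def ax_def field_simps power2_eq_square power3_eq_cube)
  then have "y \<bullet> (Da x y *v B x) - (y \<bullet> (Da x (B x) *v y)) / 2
      = (y \<bullet> (Da x y *v y)) * (b x \<bullet> y) / (2 * (alpha a x y)\<^sup>2)"
    by (simp add: H)
  with pos show "C x y y = y \<bullet> Db x y - (b x \<bullet> y / alpha a x y) * ax x y y"
    by (simp add: C_def ax_def field_simps power2_eq_square)
qed

end

section \<open>The metric alpha phi(b^2, beta/alpha) and its Hamel equation\<close>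

locale general_ab = riemannian_form U a b
  for U :: "(real^'n) set" and a :: "real^'n \<Rightarrow> real^'n^'n" and b :: "real^'n \<Rightarrow> real^'n" +
  fixes \<phi> :: "real \<Rightarrow> real \<Rightarrow> real" and D :: "(real \<times> real) set"
  assumes D: "open D" "phi_domain U a b \<subseteq> D" and \<phi>: "smooth_on D (\<lambda>(u, s). \<phi> u s)"
begin

abbreviation "F \<equiv> general_ab_metric a b \<phi>"
abbreviation "bs x y \<equiv> b x \<bullet> y / alpha a x y"
abbreviation "\<phi>0 x y \<equiv> \<phi> (bsq a b x) (bs x y)"
abbreviation "\<phi>1 x y \<equiv> d1 \<phi> (bsq a b x) (bs x y)"
abbreviation "\<phi>2 x y \<equiv> d2 \<phi> (bsq a b x) (bs x y)"
abbreviation "\<phi>12 x y \<equiv> d1 (d2 \<phi>) (bsq a b x) (bs x y)"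
abbreviation "\<phi>22 x y \<equiv> d2 (d2 \<phi>) (bsq a b x) (bs x y)"

definition "sy x y h = (b x \<bullet> h - bs x y * ay x y h) / alpha a x y"

lemma F_eq: "F x y = alpha a x y * \<phi>0 x y"
  by (simp add: general_ab_metric_def beta_def)

lemma bs_sq_le:
  assumes "x \<in> U" "y \<noteq> 0"
  shows "(bs x y)\<^sup>2 \<le> bsq a b x"
  using cauchy_schwarz[OF assms(1), of y] a_pos[OF assms]
  by (simp add: power_divide alpha_sq[OF assms(1)] pos_divide_le_eq)

lemma bs_in_D: "x \<in> U \<Longrightarrow> y \<noteq> 0 \<Longrightarrow> (bsq a b x, bs x y) \<in> D"
  using D(2) bs_sq_le by (force simp: phi_domain_def)

lemma D_memI: "x \<in> U \<Longrightarrow> s\<^sup>2 \<le> bsq a b x \<Longrightarrow> (bsq a b x, s) \<in> D"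
  using D(2) by (force simp: phi_domain_def)

lemma bs_has_derivative_y:
  assumes "x \<in> U" "y \<noteq> 0"
  shows "((\<lambda>y. bs x y) has_derivative sy x y) (at y)"
  using alpha_pos[OF assms]
  by (auto intro!: derivative_eq_intros alpha_has_derivative_y assms
      simp: sy_def fun_eq_iff field_simps)

lemma bs_has_derivative_x:
  assumes "x \<in> U" "y \<noteq> 0"
  shows "((\<lambda>x. bs x y) has_derivative (\<lambda>h. (y \<bullet> Db x h - bs x y * ax x y h) / alpha a x y)) (at x)"
  using alpha_pos[OF assms]
  by (auto intro!: derivative_eq_intros alpha_has_derivative_x b_has_derivative assms
      simp: fun_eq_iff field_simps inner_commute)

definition "Fx x y h = (\<phi>0 x y - bs x y * \<phi>2 x y) * ax x y h
    + alpha a x y * \<phi>1 x y * (2 * C x (B x) h) + \<phi>2 x y * (y \<bullet> Db x h)"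

definition "Fy x y h = \<phi>0 x y * ay x y h + alpha a x y * \<phi>2 x y * sy x y h"

definition "Fxy x y z h = (\<phi>0 x y - bs x y * \<phi>2 x y) * axy x y z h
    - bs x y * \<phi>22 x y * sy x y h * ax x y z
    + (ay x y h * \<phi>1 x y + alpha a x y * \<phi>12 x y * sy x y h) * (2 * C x (B x) z)
    + \<phi>22 x y * sy x y h * (y \<bullet> Db x z) + \<phi>2 x y * (h \<bullet> Db x z)"

lemma F_has_derivative_x:
  assumes "x \<in> U" "y \<noteq> 0"
  shows "((\<lambda>x. F x y) has_derivative Fx x y) (at x)"
proof -
  have "((\<lambda>x. (bsq a b x, bs x y)) has_derivative
      (\<lambda>h. (2 * C x (B x) h, (y \<bullet> Db x h - bs x y * ax x y h) / alpha a x y))) (at x)"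
    by (intro has_derivative_Pair bsq_has_derivative bs_has_derivative_x assms)
  from has_derivative_compose[OF this has_derivative_d1_d2[OF D(1) \<phi> bs_in_D[OF assms]]]
  have "((\<lambda>x. \<phi>0 x y) has_derivative (\<lambda>h. \<phi>1 x y * (2 * C x (B x) h)
      + \<phi>2 x y * ((y \<bullet> Db x h - bs x y * ax x y h) / alpha a x y))) (at x)"
    by simp
  from has_derivative_mult[OF alpha_has_derivative_x[OF assms] this] show ?thesis
    unfolding F_eq
    by (rule has_derivative_eq_rhs) (use alpha_pos[OF assms] in \<open>simp add: fun_eq_iff Fx_def field_simps\<close>)
qed

lemma compose_bs_has_derivative:
  assumes "x \<in> U" "y \<noteq> 0" "(f has_real_derivative f') (at (bs x y))"
  shows "((\<lambda>y. f (bs x y)) has_derivative (\<lambda>h. f' * sy x y h)) (at y)"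
  using DERIV_compose_FDERIV[OF assms(3) bs_has_derivative_y[OF assms(1,2)]]
  by (simp add: mult.commute)

lemma \<phi>_has_derivatives_y:
  assumes "x \<in> U" "y \<noteq> 0"
  shows "((\<lambda>y. \<phi>0 x y) has_derivative (\<lambda>h. \<phi>2 x y * sy x y h)) (at y)"
    and "((\<lambda>y. \<phi>1 x y) has_derivative (\<lambda>h. \<phi>12 x y * sy x y h)) (at y)"
    and "((\<lambda>y. \<phi>2 x y) has_derivative (\<lambda>h. \<phi>22 x y * sy x y h)) (at y)"
proof -
  note in_D = bs_in_D[OF assms]
  have "(d1 \<phi> (bsq a b x) has_real_derivative \<phi>12 x y) (at (bs x y))"
    using has_real_derivative_d2[OF D(1) smooth_on_d1[OF D(1) \<phi>] in_D]
      d1_d2_commute[OF D(1) \<phi> in_D] by simp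
  then show "((\<lambda>y. \<phi>1 x y) has_derivative (\<lambda>h. \<phi>12 x y * sy x y h)) (at y)"
    by (rule compose_bs_has_derivative[OF assms])
qed (rule compose_bs_has_derivative has_real_derivative_d2[OF D(1) _ bs_in_D]
    assms \<phi> smooth_on_d2[OF D(1)])+

lemma Fx_has_derivative_y:
  assumes "x \<in> U" "y \<noteq> 0"
  shows "((\<lambda>y. Fx x y z) has_derivative Fxy x y z) (at y)"
  unfolding Fx_def
  by (rule has_derivative_eq_rhs[OF has_derivative_add[OF has_derivative_add[OF
        has_derivative_mult[OF has_derivative_diff[OF \<phi>_has_derivatives_y(1)[OF assms]
            has_derivative_mult[OF bs_has_derivative_y[OF assms] \<phi>_has_derivatives_y(3)[OF assms]]]
          ax_has_derivative_y[OF assms]]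
        has_derivative_mult[OF has_derivative_mult[OF alpha_has_derivative_y[OF assms]
            \<phi>_has_derivatives_y(2)[OF assms]] has_derivative_const]]
        has_derivative_mult[OF \<phi>_has_derivatives_y(3)[OF assms]
          has_derivative_inner_left[OF has_derivative_ident]]]])
    (simp add: Fxy_def fun_eq_iff algebra_simps)

lemma F_has_derivative_y:
  assumes "x \<in> U" "y \<noteq> 0"
  shows "(F x has_derivative Fy x y) (at y)"
  unfolding F_eq[abs_def]
  by (auto intro!: derivative_eq_intros alpha_has_derivative_y
      \<phi>_has_derivatives_y assms simp: Fy_def fun_eq_iff algebra_simps)

lemma Fy_differentiable:
  assumes "x \<in> U" "y \<noteq> 0"
  shows "(\<lambda>y. Fy x y z) differentiable (at y)"
proof -
  have "(\<lambda>y. bs x y) differentiable (at y)" "(\<lambda>y. \<phi>0 x y) differentiable (at y)"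
    "(\<lambda>y. \<phi>2 x y) differentiable (at y)" "alpha a x differentiable (at y)"
    using bs_has_derivative_y \<phi>_has_derivatives_y alpha_has_derivative_y assms
    unfolding differentiable_def by blast+
  then show ?thesis
    unfolding Fy_def sy_def using alpha_pos[OF assms]
    by (intro derivative_intros ay_differentiable assms) auto
qed

lemma F_hamel:
  assumes fin: "finsler_metric U F" and x: "x \<in> U" and y: "y \<noteq> 0"
  shows "geodesic_coeff F x y = (Fx x y y / (2 * F x y)) *\<^sub>R y
      \<longleftrightarrow> (\<forall>z. Fxy x y y z = Fx x y z)"
    and "(\<Sum>k\<in>UNIV. partial k (\<lambda>x'. F x' y) x * y $ k) = Fx x y y"
  using fin x y
  by (intro hamel[of y F x "Fx x" "Fxy x y" "Fy x"];
      simp add: finsler_metric_def F_has_derivative_x Fx_has_derivative_y F_has_derivative_y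
        Fy_differentiable)+

text \<open>Hamel's equation for \<open>F\<close> contracted with \<open>z\<close>, once the terms that cancel by
  Hamel's equation for \<open>\<alpha>\<close> are removed.\<close>

definition "hamel_eq x y z \<longleftrightarrow>
    \<phi>22 x y * sy x y z * C x y y
    + 2 * (ay x y z * \<phi>1 x y + alpha a x y * \<phi>12 x y * sy x y z) * C x (B x) y
    - 2 * alpha a x y * \<phi>1 x y * C x (B x) z + \<phi>2 x y * (C x z y - C x y z) = 0"

text \<open>In \<open>Fxy x y y z - Fx x y z\<close> the derivatives of alpha gather into (phi - s
  phi_2) times the Hamel defect of alpha, which is zero, and into a term that completes the plain
  derivative of b to b_{i|j} y^i y^j. The other derivatives of b occur antisymmetrized, so the
  result is tensorial.\<close>

lemma F_flat_at_iff:
  assumes fin: "finsler_metric U F" and flat: "projectively_flat U (alpha a)"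
    and x: "x \<in> U" and y: "y \<noteq> 0"
  shows "geodesic_coeff F x y = (Fx x y y / (2 * F x y)) *\<^sub>R y \<longleftrightarrow> (\<forall>z. hamel_eq x y z)"
proof -
  have "Fxy x y y z = Fx x y z \<longleftrightarrow> hamel_eq x y z" for z
  proof -
    have "Fxy x y y z - Fx x y z = \<phi>22 x y * sy x y z * (y \<bullet> Db x y - bs x y * ax x y y)
      + 2 * (ay x y z * \<phi>1 x y + alpha a x y * \<phi>12 x y * sy x y z) * C x (B x) y
      - 2 * alpha a x y * \<phi>1 x y * C x (B x) z + \<phi>2 x y * (z \<bullet> Db x y - y \<bullet> Db x z)"
      unfolding Fxy_def Fx_def alpha_flat_imp(2)[OF flat x y] by (simp add: algebra_simps)
    then show ?thesis
      unfolding hamel_eq_def alpha_flat_imp(3)[OF flat x y] C_curl[OF x]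
      by (metis eq_iff_diff_eq_0)
  qed
  then show ?thesis by (simp add: F_hamel(1)[OF fin x y])
qed

lemma F_flat_iff:
  assumes "finsler_metric U F" "projectively_flat U (alpha a)"
  shows "projectively_flat U F \<longleftrightarrow> (\<forall>x\<in>U. \<forall>y. y \<noteq> 0 \<longrightarrow> (\<forall>z. hamel_eq x y z))"
  unfolding projectively_flat_def
  using F_hamel(2)[OF assms(1)] F_flat_at_iff[OF assms] by simp

text \<open>The coefficients of both metrics are multiples of y, so only the two projective factors
  are compared. Dividing by phi is possible since F > 0 forces phi > 0.\<close>

lemma geodesic_coeff_F:
  assumes fin: "finsler_metric U F" and flat: "projectively_flat U (alpha a)"
    and x: "x \<in> U" and y: "y \<noteq> 0" and "\<And>z. hamel_eq x y z"
  shows "geodesic_coeff F x y = geodesic_coeff (alpha a) x y +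
    ((2 * alpha a x y * \<phi>1 x y * C x (B x) y + \<phi>2 x y * C x y y) / (2 * F x y)) *\<^sub>R y"
proof -
  have pos: "alpha a x y > 0" "F x y > 0"
    using alpha_pos x y fin by (auto simp: finsler_metric_def)
  then have "\<phi>0 x y > 0" by (simp add: F_eq zero_less_mult_iff)
  with pos have "Fx x y y / (2 * F x y) = ax x y y / (2 * alpha a x y) +
      (2 * alpha a x y * \<phi>1 x y * C x (B x) y + \<phi>2 x y * C x y y) / (2 * F x y)"
    unfolding alpha_flat_imp(3)[OF flat x y] by (simp add: Fx_def F_eq field_simps)
  then show ?thesis
    using F_flat_at_iff[OF fin flat x y] assms(5)
    by (simp add: alpha_flat_imp(1)[OF flat x y] scaleR_add_left)
qed

end


section \<open>The Hamel equation at a point\<close>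

context riemannian_form
begin

lemma C_form_iff:
  assumes x: "x \<in> U"
  shows "(\<forall>i j. cov_deriv a b x i j = \<mu> * a x $ i $ j + \<nu> * b x $ i * b x $ j)
      \<longleftrightarrow> (\<forall>z y. C x z y = \<mu> * (z \<bullet> (a x *v y)) + \<nu> * (b x \<bullet> z) * (b x \<bullet> y))"
    (is "?L \<longleftrightarrow> ?R")
proof -
  define f where "f z y = \<mu> * (z \<bullet> (a x *v y)) + \<nu> * (b x \<bullet> z) * (b x \<bullet> y)" for z y
  have "bilinear f"
    unfolding bilinear_def f_def
    by (auto intro!: linearI simp: inner_add_left inner_add_right matrix_vector_right_distrib
        matrix_vector_mult_scaleR algebra_simps)
  moreover have f_axis: "f (axis i 1) (axis j 1) = \<mu> * a x $ i $ j + \<nu> * b x $ i * b x $ j" for i j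
    by (simp add: f_def inner_axis inner_axis' matrix_vector_mult_basis column_def)
  ultimately have "C x = f" if ?L
    using that bilinear_C[OF x]
    by (intro bilinear_eq_stdbasis) (auto simp: Basis_vec_def cov_deriv_eq[OF x])
  moreover have ?L if "C x = f"
    using that by (simp add: cov_deriv_eq[OF x] f_axis)
  ultimately show ?thesis
    by (auto simp: f_def fun_eq_iff)
qed

lemma obtain_normalization:
  assumes "x \<in> U" "v \<noteq> 0"
  obtains t where "t > 0" "v \<bullet> (a x *v v) = t\<^sup>2" "(v /\<^sub>R t) \<bullet> (a x *v (v /\<^sub>R t)) = 1"
proof (rule that[of "alpha a x v"])
  show "alpha a x v > 0" "v \<bullet> (a x *v v) = (alpha a x v)\<^sup>2"
    using alpha_pos[OF assms] alpha_sq[OF assms(1)] by auto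
  then show "(v /\<^sub>R alpha a x v) \<bullet> (a x *v (v /\<^sub>R alpha a x v)) = 1"
    by (simp add: matrix_vector_mult_scaleR power2_eq_square field_simps)
qed

text \<open>Two linear conditions leave a space of dimension at least n - 2 > 0. In
  \<open>C_B_perp\<close> and \<open>C_symmetric\<close> the vector w is itself perpendicular to
  beta, and then \<open>ay\<close> and \<open>sy\<close> vanish on it at a test vector built from
  v.\<close>

lemma exists_unit_perp:
  assumes dim: "CARD('n) \<ge> 3" and x: "x \<in> U"
  obtains v where "v \<bullet> (a x *v v) = 1" "b x \<bullet> v = 0" "v \<bullet> (a x *v w) = 0"
proof -
  have "dim {b x, a x *v w} \<le> card {b x, a x *v w}"
    by (rule dim_le_card') simp
  also have "\<dots> \<le> 2"
    by (rule order_trans[OF card_insert_le_m1]) auto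
  finally have "dim {b x, a x *v w} < DIM(real^'n)"
    using dim by simp
  then obtain v where v: "v \<noteq> 0" "\<And>y. y \<in> span {b x, a x *v w} \<Longrightarrow> orthogonal v y"
    by (rule orthogonal_to_subspace_exists) blast
  then have perp: "b x \<bullet> v = 0" "v \<bullet> (a x *v w) = 0"
    using v(2)[of "b x"] v(2)[of "a x *v w"] by (auto simp: span_base orthogonal_def inner_commute)
  obtain t where t: "(v /\<^sub>R t) \<bullet> (a x *v (v /\<^sub>R t)) = 1"
    using obtain_normalization[OF x v(1)] by metis
  show ?thesis
    by (rule that[OF t]) (use perp in auto)
qed

text \<open>The sign of \<open>\<sigma>\<close> is free; adding the Hamel equations for \<open>\<sigma>\<close> and \<open>-\<sigma>\<close> separates the
  terms that are even and odd in \<open>v\<close>.\<close>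

lemma test_vector:
  assumes x: "x \<in> U" and b: "b x \<noteq> 0" and v: "v \<bullet> (a x *v v) = 1" "b x \<bullet> v = 0"
    and \<sigma>: "\<sigma>\<^sup>2 = 1 - s\<^sup>2 / bsq a b x"
  defines "y \<equiv> (s / bsq a b x) *\<^sub>R B x + \<sigma> *\<^sub>R v"
  shows "alpha a x y = 1" "b x \<bullet> y = s" "y \<noteq> 0"
    "y \<bullet> (a x *v z) = s / bsq a b x * (b x \<bullet> z) + \<sigma> * (v \<bullet> (a x *v z))"
    "C x z y = s / bsq a b x * C x z (B x) + \<sigma> * C x z v"
    "C x y z = s / bsq a b x * C x (B x) z + \<sigma> * C x v z"
proof -
  define u where "u = bsq a b x"
  have u: "u > 0" using bsq_pos[OF x b] by (simp add: u_def)
  have vB: "v \<bullet> (a x *v B x) = 0" "B x \<bullet> (a x *v v) = 0" "B x \<bullet> (a x *v B x) = u" "b x \<bullet> B x = u"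
    using v(2) x by (simp_all add: inner_a_B a_sym[of x v] bsq_eq u_def)
  show ya: "y \<bullet> (a x *v z) = s / bsq a b x * (b x \<bullet> z) + \<sigma> * (v \<bullet> (a x *v z))" for z
    by (simp add: y_def inner_add_left inner_a_B[OF x])
  show b_y: "b x \<bullet> y = s"
    using u v(2) vB by (simp add: y_def inner_add_right u_def[symmetric])
  have "v \<bullet> (a x *v y) = \<sigma>"
    using ya[of v] v vB a_sym[OF x, of v y] by simp
  then have "y \<bullet> (a x *v y) = 1"
    using ya[of y] b_y \<sigma> u by (simp add: u_def[symmetric] field_simps power2_eq_square)
  then show "alpha a x y = 1" by (simp add: alpha_def)
  then show "y \<noteq> 0" by (auto simp: alpha_def)
  show "C x z y = s / bsq a b x * C x z (B x) + \<sigma> * C x z v"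
    "C x y z = s / bsq a b x * C x (B x) z + \<sigma> * C x v z"
    by (simp_all add: y_def C_add_left[OF x] C_add_right[OF x] C_scaleR_left[OF x] C_scaleR_right[OF x])
qed

text \<open>A symmetric form is determined by its quadratic form. Splitting y into a multiple of B
  and a part perpendicular to beta leaves no mixed terms, so the values on the two parts
  suffice.\<close>

lemma C_form_symmetric:
  assumes x: "x \<in> U" and b: "b x \<noteq> 0"
    and sym: "\<And>z y. C x z y = C x y z"
    and CB: "\<And>w. b x \<bullet> w = 0 \<Longrightarrow> C x (B x) w = 0"
    and Cv: "\<And>v. v \<bullet> (a x *v v) = 1 \<Longrightarrow> b x \<bullet> v = 0 \<Longrightarrow> C x v v = \<mu>"
  shows "C x z y = \<mu> * (z \<bullet> (a x *v y))
      + (C x (B x) (B x) / (bsq a b x)\<^sup>2 - \<mu> / bsq a b x) * (b x \<bullet> z) * (b x \<bullet> y)"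
proof -
  define u where "u = bsq a b x"
  have u: "u > 0" using bsq_pos[OF x b] by (simp add: u_def)
  have bB: "b x \<bullet> B x = u" by (simp add: u_def bsq_eq)
  \<comment> \<open>Forced by evaluation at B, where the form must give mu b^2 + nu b^4.\<close>
  define \<nu> where "\<nu> = C x (B x) (B x) / u\<^sup>2 - \<mu> / u"
  have perp: "C x w w = \<mu> * (w \<bullet> (a x *v w))" if "b x \<bullet> w = 0" for w
  proof (cases "w = 0")
    case False
    obtain t where t: "t > 0" "w \<bullet> (a x *v w) = t\<^sup>2" "(w /\<^sub>R t) \<bullet> (a x *v (w /\<^sub>R t)) = 1"
      using obtain_normalization[OF x False] by metis
    have "C x (w /\<^sub>R t) (w /\<^sub>R t) = \<mu>"
      by (rule Cv[OF t(3)]) (use that in auto)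
    then show ?thesis
      using t by (simp add: C_scaleR_left[OF x] C_scaleR_right[OF x] field_simps power2_eq_square)
  qed (use C_scaleR_left[OF x, of 0] in simp)
  have quad: "C x y y = \<mu> * (y \<bullet> (a x *v y)) + \<nu> * (b x \<bullet> y) * (b x \<bullet> y)" for y
  proof -
    define t where "t = (b x \<bullet> y) / u"
    define w where "w = y - t *\<^sub>R B x"
    have w: "b x \<bullet> w = 0" "y = t *\<^sub>R B x + w"
      using u bB by (simp_all add: w_def t_def inner_diff_right)
    have "C x w (B x) = 0" "C x (B x) w = 0" using CB[OF w(1)] sym by auto
    then have "C x y y = t\<^sup>2 * C x (B x) (B x) + \<mu> * (w \<bullet> (a x *v w))"
      using perp[OF w(1)] unfolding w(2)
      by (simp add: C_add_left[OF x] C_add_right[OF x] C_scaleR_left[OF x] C_scaleR_right[OF x]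
          power2_eq_square)
    moreover have "w \<bullet> (a x *v B x) = 0" "B x \<bullet> (a x *v w) = 0" "B x \<bullet> (a x *v B x) = u"
      using w(1) bB x by (simp_all add: inner_a_B a_sym[of x w])
    then have "y \<bullet> (a x *v y) = t\<^sup>2 * u + w \<bullet> (a x *v w)"
      unfolding w(2)
      by (simp add: matrix_vector_right_distrib matrix_vector_mult_scaleR inner_add_left
          inner_add_right power2_eq_square)
    moreover have "b x \<bullet> y = t * u" using u by (simp add: t_def)
    ultimately show ?thesis
      using u by (simp add: \<nu>_def field_simps power2_eq_square)
  qed
  have "2 * C x z y = C x (z + y) (z + y) - C x z z - C x y y"
    using sym[of y z] by (simp add: C_add_left[OF x] C_add_right[OF x])
  also have "\<dots> = 2 * (\<mu> * (z \<bullet> (a x *v y)) + \<nu> * (b x \<bullet> z) * (b x \<bullet> y))"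
    unfolding quad using a_sym[OF x, of y z]
    by (simp add: matrix_vector_right_distrib inner_add_left inner_add_right algebra_simps)
  finally show ?thesis by (simp add: \<nu>_def u_def)
qed

end

context general_ab
begin

text \<open>At the test vector alpha = 1 and beta/alpha = s, so phi and its derivatives are
  evaluated at a prescribed s. The functional \<open>n\<close> is a(y, .), which equals
  \<open>ay\<close> at a unit vector, and \<open>b x \<bullet> z - s * n z\<close> is
  \<open>sy\<close>.\<close>

lemma hamel_at_test_vector:
  assumes x: "x \<in> U" and b: "b x \<noteq> 0" and v: "v \<bullet> (a x *v v) = 1" "b x \<bullet> v = 0"
    and \<sigma>: "\<sigma>\<^sup>2 = 1 - s\<^sup>2 / bsq a b x"
    and hamel: "\<And>y z. y \<noteq> 0 \<Longrightarrow> hamel_eq x y z"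
  defines "u \<equiv> bsq a b x"
  defines "n \<equiv> \<lambda>z. s / u * (b x \<bullet> z) + \<sigma> * (v \<bullet> (a x *v z))"
  shows "d2 (d2 \<phi>) u s * (b x \<bullet> z - s * n z) *
        ((s / u)\<^sup>2 * C x (B x) (B x) + s / u * \<sigma> * (C x (B x) v + C x v (B x)) + \<sigma>\<^sup>2 * C x v v)
      + 2 * (n z * d1 \<phi> u s + d1 (d2 \<phi>) u s * (b x \<bullet> z - s * n z))
        * (s / u * C x (B x) (B x) + \<sigma> * C x (B x) v)
      - 2 * d1 \<phi> u s * C x (B x) z
      + d2 \<phi> u s * (s / u * (C x z (B x) - C x (B x) z) + \<sigma> * (C x z v - C x v z)) = 0"
proof -
  define y where "y = (s / u) *\<^sub>R B x + \<sigma> *\<^sub>R v"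
  note y = test_vector[OF x b v \<sigma>, folded u_def, folded y_def]
  have "ay x y z = n z" "sy x y z = b x \<bullet> z - s * n z"
    by (simp_all add: ay_def sy_def y n_def)
  moreover have "C x y y = (s / u)\<^sup>2 * C x (B x) (B x) + s / u * \<sigma> * (C x (B x) v + C x v (B x)) + \<sigma>\<^sup>2 * C x v v"
    unfolding y(5)[of y] y(6)[of "B x"] y(6)[of v] by (simp add: algebra_simps power2_eq_square)
  moreover have "C x z y - C x y z = s / u * (C x z (B x) - C x (B x) z) + \<sigma> * (C x z v - C x v z)"
    unfolding y(5)[of z] y(6)[of z] by (simp add: algebra_simps)
  ultimately show ?thesis
    using hamel[OF y(3), of z] unfolding hamel_eq_def
    by (simp add: y(1,2) y(5)[of "B x"] flip: u_def)
qed

text \<open>For s = 0 and v perpendicular to both beta and w, \<open>ay\<close> and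
  \<open>sy\<close> vanish on w, leaving the phi_1 term and the phi_2 term. The latter is odd in
  sigma and disappears when the equations for sigma = 1 and sigma = -1 are added.\<close>

lemma C_B_perp:
  assumes dim: "CARD('n) \<ge> 3" and x: "x \<in> U" and b: "b x \<noteq> 0"
    and hamel: "\<And>y z. y \<noteq> 0 \<Longrightarrow> hamel_eq x y z"
    and nz: "d1 \<phi> (bsq a b x) 0 \<noteq> 0" and w: "b x \<bullet> w = 0"
  shows "C x (B x) w = 0"
proof -
  obtain v where v: "v \<bullet> (a x *v v) = 1" "b x \<bullet> v = 0" "v \<bullet> (a x *v w) = 0"
    using exists_unit_perp[OF dim x] by blast
  have "4 * d1 \<phi> (bsq a b x) 0 * C x (B x) w = 0"
    using hamel_at_test_vector[OF x b v(1,2) _ hamel, of 1 0 w]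
      hamel_at_test_vector[OF x b v(1,2) _ hamel, of "-1" 0 w] v(3) w
    by (simp add: algebra_simps)
  then show ?thesis using nz by simp
qed

text \<open>Now s = 0 and z = B, where \<open>ay\<close> is 0 and \<open>sy\<close> is b^2; adding
  both signs of sigma again removes the odd terms. This ties the eigenvalue perpendicular to beta to
  the one along B.\<close>

lemma hamel_at_perp:
  assumes x: "x \<in> U" and b: "b x \<noteq> 0"
    and hamel: "\<And>y z. y \<noteq> 0 \<Longrightarrow> hamel_eq x y z"
    and v: "v \<bullet> (a x *v v) = 1" "b x \<bullet> v = 0"
  shows "d2 (d2 \<phi>) (bsq a b x) 0 * bsq a b x * C x v v = 2 * d1 \<phi> (bsq a b x) 0 * C x (B x) (B x)"
proof -
  have vB: "v \<bullet> (a x *v B x) = 0" using v(2) by (simp add: a_B[OF x] inner_commute)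
  show ?thesis
    using hamel_at_test_vector[OF x b v(1,2) _ hamel, of 1 0 "B x"]
      hamel_at_test_vector[OF x b v(1,2) _ hamel, of "-1" 0 "B x"] vB
    by (simp add: bsq_eq algebra_simps)
qed

text \<open>The precursor of the equation for phi, from z = B at arbitrary s. It gives no
  information on phi where C(B, B) and C(v, v) both vanish.\<close>

lemma hamel_even_part:
  assumes x: "x \<in> U" and b: "b x \<noteq> 0"
    and hamel: "\<And>y z. y \<noteq> 0 \<Longrightarrow> hamel_eq x y z"
    and CB: "C x (B x) v = 0"
    and v: "v \<bullet> (a x *v v) = 1" "b x \<bullet> v = 0" and s: "s\<^sup>2 < bsq a b x"
  defines "u \<equiv> bsq a b x"
  shows "d2 (d2 \<phi>) u s * (s\<^sup>2 * C x (B x) (B x) / u + (u - s\<^sup>2) * C x v v)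
    = 2 * (d1 \<phi> u s - s * d1 (d2 \<phi>) u s) * C x (B x) (B x)"
proof -
  have u: "u > 0" using bsq_pos[OF x b] by (simp add: u_def)
  define \<sigma> where "\<sigma> = sqrt (1 - s\<^sup>2 / u)"
  have \<sigma>: "\<sigma>\<^sup>2 = 1 - s\<^sup>2 / u"
    using u s by (simp add: \<sigma>_def u_def)
  have vB: "v \<bullet> (a x *v B x) = 0" using v(2) by (simp add: a_B[OF x] inner_commute)
  have bB: "b x \<bullet> B x = u" by (simp add: u_def bsq_eq)
  have eq: "d2 (d2 \<phi>) u s * (u - s * s) *
        ((s / u)\<^sup>2 * C x (B x) (B x) + s / u * t * C x v (B x) + (1 - s\<^sup>2 / u) * C x v v)
      + 2 * (s * d1 \<phi> u s + d1 (d2 \<phi>) u s * (u - s * s)) * (s / u * C x (B x) (B x))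
      - 2 * d1 \<phi> u s * C x (B x) (B x) - d2 \<phi> u s * (t * C x v (B x)) = 0"
    if t: "t\<^sup>2 = 1 - s\<^sup>2 / u" for t
    using hamel_at_test_vector[OF x b v(1,2) t[unfolded u_def] hamel, of "B x"] vB bB CB u t
    by (simp flip: u_def)
  \<comment> \<open>The mean of the equations for sigma and -sigma; the odd terms are those
    containing C(v, B).\<close>
  have odd_cancel: "P * (Q + S) + L - M = 0"
    if "P * (Q + r * \<sigma> * m + S) + L - M - e * (\<sigma> * m) = 0"
      "P * (Q + r * (- \<sigma>) * m + S) + L - M - e * ((- \<sigma>) * m) = 0" for P Q S L M r m e
    using that by (simp add: algebra_simps)
  \<comment> \<open>After multiplication by u the two phi_1 terms combine to -2 (u - s^2) phi_1 C(B,
    B). The other terms carry the value u - s^2 of \<open>sy\<close> at B, so this is a common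
    factor, which can be cancelled for s^2 < b^2.\<close>
  have "(u - s\<^sup>2) * (d2 (d2 \<phi>) u s * (s\<^sup>2 * C x (B x) (B x) / u + (u - s\<^sup>2) * C x v v)
      - 2 * (d1 \<phi> u s - s * d1 (d2 \<phi>) u s) * C x (B x) (B x))
    = u * (d2 (d2 \<phi>) u s * (u - s * s) * ((s / u)\<^sup>2 * C x (B x) (B x) + (1 - s\<^sup>2 / u) * C x v v)
      + 2 * (s * d1 \<phi> u s + d1 (d2 \<phi>) u s * (u - s * s)) * (s / u * C x (B x) (B x))
      - 2 * d1 \<phi> u s * C x (B x) (B x))"
    using u by (simp add: field_simps power2_eq_square)
  also have "\<dots> = 0"
    using odd_cancel[OF eq[OF \<sigma>] eq[of "- \<sigma>"]] \<sigma> by simp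
  finally have "(u - s\<^sup>2) * (d2 (d2 \<phi>) u s * (s\<^sup>2 * C x (B x) (B x) / u + (u - s\<^sup>2) * C x v v)
      - 2 * (d1 \<phi> u s - s * d1 (d2 \<phi>) u s) * C x (B x) (B x)) = 0" .
  with s show ?thesis by (simp add: u_def)
qed

text \<open>On w perpendicular to beta and to v only the phi_2 term survives: (s/b^2) A(w, B) +
  sigma A(w, v) = 0 for the antisymmetric part A. The two signs of sigma separate the summands,
  which takes a nonzero s with phi_2 nonzero.\<close>

lemma C_symmetric:
  assumes dim: "CARD('n) \<ge> 3" and x: "x \<in> U" and b: "b x \<noteq> 0"
    and hamel: "\<And>y z. y \<noteq> 0 \<Longrightarrow> hamel_eq x y z"
    and CB: "\<And>w. b x \<bullet> w = 0 \<Longrightarrow> C x (B x) w = 0"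
    and s: "s\<^sup>2 < bsq a b x" "s \<noteq> 0" "d2 \<phi> (bsq a b x) s \<noteq> 0"
  shows "C x z y = C x y z"
proof -
  define u where "u = bsq a b x"
  have u: "u > 0" using bsq_pos[OF x b] by (simp add: u_def)
  define \<sigma> where "\<sigma> = sqrt (1 - s\<^sup>2 / u)"
  have \<sigma>: "\<sigma>\<^sup>2 = 1 - s\<^sup>2 / u" "\<sigma> > 0"
    using u s by (simp_all add: \<sigma>_def u_def)
  define A where "A z y = C x z y - C x y z" for z y
  have unit: "A w (B x) = 0 \<and> A w v = 0"
    if "v \<bullet> (a x *v v) = 1" "b x \<bullet> v = 0" "v \<bullet> (a x *v w) = 0" "b x \<bullet> w = 0" for v w
  proof -
    have "s / u * A w (B x) + t * A w v = 0" if "t\<^sup>2 = \<sigma>\<^sup>2" for t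
      using hamel_at_test_vector[OF x b \<open>v \<bullet> (a x *v v) = 1\<close> \<open>b x \<bullet> v = 0\<close> _ hamel, of t s w]
        \<open>v \<bullet> (a x *v w) = 0\<close> \<open>b x \<bullet> w = 0\<close> CB[OF \<open>b x \<bullet> w = 0\<close>] s(3) that
      by (simp add: \<sigma>(1) A_def flip: u_def)
    from this[of \<sigma>] this[of "- \<sigma>"] show ?thesis
      using \<sigma>(2) s(2) u by (simp add: field_simps)
  qed
  have AB: "A w (B x) = 0" if "b x \<bullet> w = 0" for w
    using exists_unit_perp[OF dim x, of w] unit that by metis
  note lin = C_add_left[OF x] C_add_right[OF x] C_scaleR_left[OF x] C_scaleR_right[OF x]
  have A_lin: "A (z + z') y = A z y + A z' y" "A (r *\<^sub>R z) y = r * A z y"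
    "A z (y + y') = A z y + A z y'" "A z (r *\<^sub>R y) = r * A z y" "A y z = - A z y" for z z' y y' r
    by (simp_all add: A_def lin algebra_simps)
  have A_self: "A y y = 0" for y by (simp add: A_def)
  have perp: "A w v = 0" if "b x \<bullet> w = 0" "b x \<bullet> v = 0" for w v
  proof (cases "v = 0")
    case True
    then show ?thesis using A_lin(4)[of w 0 v] by simp
  next
    case False
    obtain t where t: "t > 0" "v \<bullet> (a x *v v) = t\<^sup>2" "(v /\<^sub>R t) \<bullet> (a x *v (v /\<^sub>R t)) = 1"
      using obtain_normalization[OF x False] by metis
    \<comment> \<open>The Gram-Schmidt coefficient: w - r v is perpendicular to v, and A(w, v) does
      not change because A(v, v) = 0.\<close>
    define r where "r = (v \<bullet> (a x *v w)) / t\<^sup>2"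
    have "A (w + (- r) *\<^sub>R v) (v /\<^sub>R t) = 0"
      by (rule unit[THEN conjunct2, OF t(3)])
        (use t that in \<open>auto simp: matrix_vector_mult_diff_distrib matrix_vector_mult_scaleR
          inner_diff_right r_def\<close>)
    then have "A (w + (- r) *\<^sub>R v) v = 0"
      using t by (simp only: A_lin(4)) simp
    then show ?thesis by (simp only: A_lin(1,2) A_self)
  qed
  have decomp: "\<exists>t w. y = t *\<^sub>R B x + w \<and> b x \<bullet> w = 0" for y
    using u by (intro exI[of _ "(b x \<bullet> y) / u"] exI[of _ "y - ((b x \<bullet> y) / u) *\<^sub>R B x"])
      (simp add: inner_diff_right u_def bsq_eq)
  obtain t w t' w' where "z = t *\<^sub>R B x + w" "b x \<bullet> w = 0" "y = t' *\<^sub>R B x + w'" "b x \<bullet> w' = 0"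
    using decomp[of z] decomp[of y] by blast
  then have "A z y = 0"
    using AB perp A_self A_lin(5)[of "B x" w'] by (simp add: A_lin(1-4))
  then show ?thesis by (simp add: A_def)
qed

text \<open>Under this form of b_{i|j} the left-hand side of \<open>hamel_eq\<close> factors as k
  alpha^2 \<open>sy\<close> times the difference of the two sides of the equation for phi; z enters
  through \<open>sy\<close> alone.\<close>

lemma hamel_eq_if_C_form:
  assumes x: "x \<in> U" and y: "y \<noteq> 0"
    and C: "\<And>z y. C x z y = k * c * (bsq a b x * (z \<bullet> (a x *v y)) - (b x \<bullet> z) * (b x \<bullet> y))
      + k * (b x \<bullet> z) * (b x \<bullet> y)"
    and eq: "(c * bsq a b x - (c - 1) * (bs x y)\<^sup>2) * \<phi>22 x y
      = 2 * bsq a b x * (\<phi>1 x y - bs x y * \<phi>12 x y)"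
  shows "hamel_eq x y z"
    and "C x (B x) y = k * bsq a b x * bs x y * alpha a x y"
    and "C x y y = k * (alpha a x y)\<^sup>2 * (c * (bsq a b x - (bs x y)\<^sup>2) + (bs x y)\<^sup>2)"
proof -
  define u s \<alpha> where "u = bsq a b x" and "s = bs x y" and "\<alpha> = alpha a x y"
  have \<alpha>: "\<alpha> > 0" using alpha_pos[OF x y] by (simp add: \<alpha>_def)
  have b_y: "b x \<bullet> y = s * \<alpha>" using \<alpha> by (simp add: s_def \<alpha>_def)
  have bz: "b x \<bullet> z = \<alpha> * sy x y z + s * ay x y z"
    using \<alpha> by (simp add: sy_def s_def \<alpha>_def)
  have CB: "C x (B x) w = k * u * (b x \<bullet> w)" for w
    unfolding C by (simp add: inner_a_B[OF x] bsq_eq u_def algebra_simps)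
  then have "C x (B x) y = k * u * s * \<alpha>"
    using b_y by simp
  then show "C x (B x) y = k * bsq a b x * bs x y * alpha a x y"
    by (simp only: u_def s_def \<alpha>_def)
  have Cyy: "C x y y = k * \<alpha>\<^sup>2 * (c * (u - s\<^sup>2) + s\<^sup>2)"
    unfolding C alpha_sq[OF x, symmetric] b_y
    by (simp add: algebra_simps power2_eq_square flip: \<alpha>_def u_def)
  then show "C x y y = k * (alpha a x y)\<^sup>2 * (c * (bsq a b x - (bs x y)\<^sup>2) + (bs x y)\<^sup>2)"
    by (simp only: u_def s_def \<alpha>_def)
  have "C x z y = C x y z" unfolding C using a_sym[OF x, of z y] by simp
  then have "hamel_eq x y z \<longleftrightarrow>
    k * \<alpha>\<^sup>2 * sy x y z * ((c * u - (c - 1) * s\<^sup>2) * \<phi>22 x y - 2 * u * (\<phi>1 x y - s * \<phi>12 x y)) = 0"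
    unfolding hamel_eq_def Cyy CB b_y bz
    by (simp add: algebra_simps power2_eq_square flip: \<alpha>_def u_def)
  then show "hamel_eq x y z" using eq by (simp add: u_def s_def)
qed

lemma hamel_eq_if_C_eq_0: "(\<And>z y. C x z y = 0) \<Longrightarrow> hamel_eq x y z"
  by (simp add: hamel_eq_def)

text \<open>Where b = 0, also B, s and \<open>sy\<close> vanish, and only the phi_2 term is left,
  which contains just the exterior derivative of beta.\<close>

lemma hamel_eq_at_zero:
  assumes "b x = 0" "\<And>z y. C x z y = C x y z" "x \<in> U"
  shows "hamel_eq x y z"
proof -
  have "C x (B x) w = 0" for w
    using assms C_scaleR_left[of x 0 0 w] B_eq_0_iff[of x] by simp
  then show ?thesis using assms by (simp add: hamel_eq_def sy_def)
qed

end


section \<open>Level sets of the norm and projective flatness\<close>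

text \<open>Along the segment from x0 to z the increment g of f makes g^2 exp(-2 L t) nonincreasing,
  with initial value 0. The square stands in for |g|, which need not be differentiable.\<close>

lemma constant_if_derivative_le_multiple:
  fixes f :: "'a::real_normed_vector \<Rightarrow> real"
  assumes f: "\<And>x. x \<in> ball x0 r \<Longrightarrow> (f has_derivative f' x) (at x)"
    and le: "\<And>x h. x \<in> ball x0 r \<Longrightarrow> \<bar>f' x h\<bar> \<le> K * \<bar>f x - f x0\<bar> * norm h"
    and z: "z \<in> ball x0 r"
  shows "f z = f x0"
proof -
  define L where "L = K * norm (z - x0)"
  define p where "p t = x0 + t *\<^sub>R (z - x0)" for t :: real
  define g where "g t = f (p t) - f x0" for t
  have p: "p t \<in> ball x0 r" if "0 \<le> t" "t \<le> 1" for t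
  proof -
    have "norm (t *\<^sub>R (z - x0)) \<le> norm (z - x0)"
      using that by (simp add: mult_left_le_one_le)
    also have "\<dots> < r" using z by (simp add: dist_norm norm_minus_commute)
    finally show ?thesis by (simp add: p_def dist_norm)
  qed
  have "(g 1)\<^sup>2 * exp (- 2 * L * 1) \<le> (g 0)\<^sup>2 * exp (- 2 * L * 0)"
  proof (rule DERIV_nonpos_imp_nonincreasing[of 0 1 "\<lambda>t. (g t)\<^sup>2 * exp (- 2 * L * t)"])
    fix t :: real assume t: "0 \<le> t" "t \<le> 1"
    have "(p has_derivative (\<lambda>h. h *\<^sub>R (z - x0))) (at t)"
      unfolding p_def by (auto intro!: derivative_eq_intros)
    from has_derivative_compose[OF this f[OF p[OF t]]]
    have "((\<lambda>t. f (p t)) has_derivative (\<lambda>h. f' (p t) (h *\<^sub>R (z - x0)))) (at t)" .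
    moreover have "(\<lambda>h. f' (p t) (h *\<^sub>R (z - x0))) = (*) (f' (p t) (z - x0))"
      using f[OF p[OF t], THEN has_derivative_linear] by (simp add: fun_eq_iff linear_cmul mult.commute)
    ultimately have "((\<lambda>t. f (p t)) has_real_derivative f' (p t) (z - x0)) (at t)"
      by (simp only: has_field_derivative_def)
    then have g: "(g has_real_derivative f' (p t) (z - x0)) (at t)"
      unfolding g_def by (auto intro!: derivative_eq_intros)
    have "((\<lambda>t. (g t)\<^sup>2 * exp (- 2 * L * t)) has_real_derivative
        2 * (g t * f' (p t) (z - x0) - L * (g t)\<^sup>2) * exp (- 2 * L * t)) (at t)"
      using g by (auto intro!: derivative_eq_intros simp: algebra_simps)
    moreover have "g t * f' (p t) (z - x0) \<le> \<bar>g t\<bar> * \<bar>f' (p t) (z - x0)\<bar>"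
      by (simp flip: abs_mult)
    then have "g t * f' (p t) (z - x0) \<le> \<bar>g t\<bar> * (L * \<bar>g t\<bar>)"
      using mult_left_mono[OF le[OF p[OF t], of "z - x0"], of "\<bar>g t\<bar>"]
      by (simp add: L_def g_def mult_ac)
    then have "g t * f' (p t) (z - x0) - L * (g t)\<^sup>2 \<le> 0"
      by (simp add: power2_eq_square mult_ac)
    ultimately show "\<exists>y. ((\<lambda>t. (g t)\<^sup>2 * exp (- 2 * L * t)) has_real_derivative y) (at t) \<and> y \<le> 0"
      by (auto simp: mult_le_0_iff)
  qed simp
  then have "(g 1)\<^sup>2 \<le> 0" by (simp add: g_def p_def mult_le_0_iff)
  then show ?thesis by (simp add: g_def p_def)
qed

lemma isCont_tendsto_nhds: "isCont f x \<Longrightarrow> (f \<longlongrightarrow> f x) (nhds x)"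
  by (simp only: isCont_def tendsto_at_iff_tendsto_nhds)

lemma locally_constant_level_imp_constant:
  fixes f :: "'a::topological_space \<Rightarrow> real"
  assumes "connected U" "continuous_on U f" "x0 \<in> U"
    and nhd: "\<And>x. x \<in> U \<Longrightarrow> f x = f x0 \<Longrightarrow> \<forall>\<^sub>F y in nhds x. f y = f x0"
    and "y \<in> U"
  shows "f y = f x0"
proof -
  let ?T = "{x \<in> U. f x = f x0}"
  have "closedin (top_of_set U) ?T"
    by (rule continuous_closedin_preimage_constant[OF assms(2)])
  moreover have "openin (top_of_set U) ?T"
    unfolding openin_subopen[of _ ?T]
  proof
    fix x assume "x \<in> ?T"
    then obtain V where "open V" "x \<in> V" "\<And>y. y \<in> V \<Longrightarrow> f y = f x0"
      using nhd[of x] unfolding eventually_nhds by auto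
    then show "\<exists>T. openin (top_of_set U) T \<and> x \<in> T \<and> T \<subseteq> ?T"
      using \<open>x \<in> ?T\<close> by (intro exI[of _ "U \<inter> V"]) (auto simp: openin_open)
  qed
  ultimately have "?T = {} \<or> ?T = U"
    using assms(1) connected_clopen by blast
  with assms(3,5) show ?thesis by auto
qed

lemma DERIV_eventually_le:
  fixes f :: "real \<Rightarrow> real"
  assumes "(f has_real_derivative l) (at x)"
  shows "\<forall>\<^sub>F y in nhds x. \<bar>f y - f x\<bar> \<le> (\<bar>l\<bar> + 1) * \<bar>y - x\<bar>"
proof -
  have "\<forall>\<^sub>F y in at x. dist ((f y - f x) / (y - x)) l < 1"
    using assms unfolding has_field_derivative_iff by (rule tendstoD) simp
  then show ?thesis
    unfolding eventually_at_filter
  proof eventually_elim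
    case (elim y)
    show ?case
    proof (cases "y = x")
      case False
      have "\<bar>(f y - f x) / (y - x) - l\<bar> < 1"
        using elim False by (simp add: dist_real_def)
      then have "\<bar>(f y - f x) / (y - x)\<bar> \<le> \<bar>l\<bar> + 1"
        by linarith
      then show ?thesis using False by (simp add: field_simps abs_divide)
    qed simp
  qed
qed

context general_ab
begin

lemma C_B_eq_0_if_bsq_constant:
  assumes x: "x \<in> U" and "\<And>y. y \<in> U \<Longrightarrow> bsq a b y = u"
  shows "C x (B x) h = 0"
proof -
  have "(bsq a b has_derivative (\<lambda>h. 0)) (at x)"
    by (rule has_derivative_transform_within_open[OF has_derivative_const[of u] U x])
      (simp add: assms(2))
  from fun_cong[OF has_derivative_unique[OF this bsq_has_derivative[OF x]], of h]
  show ?thesis by simp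
qed

lemma bsq_isCont: "x \<in> U \<Longrightarrow> isCont (bsq a b) x"
  using bsq_has_derivative has_derivative_continuous by blast

text \<open>The bound is demanded only near points of one level, and K may vary from point to point,
  since Gronwall is applied in a small ball around each of them.\<close>

lemma bsq_constant_if_gronwall:
  assumes "connected U" "x0 \<in> U"
    and bound: "\<And>x. x \<in> U \<Longrightarrow> bsq a b x = bsq a b x0 \<Longrightarrow>
      \<exists>K. \<forall>\<^sub>F y in nhds x. \<forall>h. \<bar>C y (B y) h\<bar> \<le> K * \<bar>bsq a b y - bsq a b x0\<bar> * norm h"
    and "y \<in> U"
  shows "bsq a b y = bsq a b x0"
proof (rule locally_constant_level_imp_constant[OF assms(1) _ assms(2) _ assms(4)])
  show "continuous_on U (bsq a b)"
    using bsq_isCont by (simp add: continuous_at_imp_continuous_on)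
  fix x assume x: "x \<in> U" "bsq a b x = bsq a b x0"
  obtain K where "\<forall>\<^sub>F y in nhds x. \<forall>h. \<bar>C y (B y) h\<bar> \<le> K * \<bar>bsq a b y - bsq a b x\<bar> * norm h"
    using bound[OF x] x(2) by auto
  moreover have "\<forall>\<^sub>F y in nhds x. y \<in> U"
    using U x(1) eventually_nhds by blast
  ultimately have "\<forall>\<^sub>F y in nhds x. y \<in> U \<and> (\<forall>h. \<bar>C y (B y) h\<bar> \<le> K * \<bar>bsq a b y - bsq a b x\<bar> * norm h)"
    by eventually_elim auto
  then obtain r where r: "r > 0"
    "\<And>y. y \<in> ball x r \<Longrightarrow> y \<in> U \<and> (\<forall>h. \<bar>C y (B y) h\<bar> \<le> K * \<bar>bsq a b y - bsq a b x\<bar> * norm h)"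
    unfolding eventually_nhds_metric by (auto simp: dist_commute)
  have "bsq a b z = bsq a b x" if "z \<in> ball x r" for z
  proof (rule constant_if_derivative_le_multiple[OF _ _ that])
    show "(bsq a b has_derivative (\<lambda>h. 2 * C y (B y) h)) (at y)" if "y \<in> ball x r" for y
      using r(2)[OF that] bsq_has_derivative by blast
    show "\<bar>2 * C y (B y) h\<bar> \<le> 2 * K * \<bar>bsq a b y - bsq a b x\<bar> * norm h" if "y \<in> ball x r" for y h
      using r(2)[OF that] by (simp add: abs_mult mult.assoc)
  qed
  then show "\<forall>\<^sub>F y in nhds x. bsq a b y = bsq a b x0"
    using r(1) x(2) unfolding eventually_nhds_metric by (auto simp: dist_commute)
qed

section \<open>The function phi on a single level of b^2\<close>

lemma D_isCont:
  fixes f :: "real \<Rightarrow> real \<Rightarrow> real"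
  assumes "smooth_on D (\<lambda>(u, s). f u s)" "(u, s) \<in> D"
  shows "isCont (\<lambda>u. f u s) u" "isCont (f u) s"
  using has_real_derivative_d1[OF D(1) assms] has_real_derivative_d2[OF D(1) assms]
  by (auto intro: DERIV_isCont)

lemma smooth_\<phi>_derivs:
  "smooth_on D (\<lambda>(u, s). d1 \<phi> u s)" "smooth_on D (\<lambda>(u, s). d2 \<phi> u s)"
  "smooth_on D (\<lambda>(u, s). d1 (d2 \<phi>) u s)" "smooth_on D (\<lambda>(u, s). d2 (d2 \<phi>) u s)"
  using smooth_on_d1[OF D(1)] smooth_on_d2[OF D(1)] \<phi> by blast+

text \<open>Supplies the s that \<open>C_symmetric\<close> asks for. If phi_2 vanished at every
  nonzero s, so would phi_22, and by continuity also at s = 0.\<close>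

lemma exists_d2_nonzero:
  assumes x: "x \<in> U" and s1: "s1\<^sup>2 < bsq a b x" "d2 (d2 \<phi>) (bsq a b x) s1 \<noteq> 0"
  shows "\<exists>s. s \<noteq> 0 \<and> s\<^sup>2 < bsq a b x \<and> d2 \<phi> (bsq a b x) s \<noteq> 0"
proof (rule ccontr)
  define u where "u = bsq a b x"
  assume "\<not> ?thesis"
  then have zero: "d2 \<phi> u s = 0" if "s \<noteq> 0" "s\<^sup>2 < u" for s
    using that by (auto simp: u_def)
  have inD: "(u, s) \<in> D" if "s\<^sup>2 < u" for s
    using D_memI[OF x] that by (simp add: u_def)
  have "open {s. s\<^sup>2 < u}"
    by (intro open_Collect_less continuous_intros)
  then have opn: "open ({s. s\<^sup>2 < u} - {0})" by (rule open_delete)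
  have zero2: "d2 (d2 \<phi>) u s = 0" if "s \<noteq> 0" "s\<^sup>2 < u" for s
  proof -
    have "(d2 \<phi> u has_real_derivative 0) (at s)"
      by (rule has_field_derivative_transform_within_open[OF DERIV_const[of 0] opn])
        (use that zero in auto)
    from DERIV_unique[OF has_real_derivative_d2[OF D(1) smooth_\<phi>_derivs(2) inD[OF that(2)]] this]
    show ?thesis .
  qed
  have u: "0 < u" using s1(1) le_less_trans[OF zero_le_power2[of s1]] by (simp add: u_def)
  have "(d2 (d2 \<phi>) u \<longlongrightarrow> d2 (d2 \<phi>) u 0) (at 0)"
    using D_isCont(2)[OF smooth_\<phi>_derivs(4) inD[of 0]] u by (simp add: isCont_def)
  moreover have "(d2 (d2 \<phi>) u \<longlongrightarrow> 0) (at 0)"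
  proof (rule tendsto_eventually)
    show "\<forall>\<^sub>F s in at 0. d2 (d2 \<phi>) u s = 0"
      unfolding eventually_at_topological
      using \<open>open {s. s\<^sup>2 < u}\<close> u zero2 by (intro exI[of _ "{s. s\<^sup>2 < u}"]) auto
  qed
  ultimately have "d2 (d2 \<phi>) u 0 = 0"
    using tendsto_unique[OF at_neq_bot] by blast
  with zero2 s1 show False by (cases "s1 = 0") (auto simp: u_def)
qed

text \<open>The conclusion includes s^2 = b^2, which beta/alpha attains at multiples of the dual
  vector; these end points are reached by continuity of phi and phi_2.\<close>

lemma affine_if_d22_eq_0:
  assumes x: "x \<in> U" and u: "bsq a b x > 0"
    and zero: "\<And>s. s\<^sup>2 < bsq a b x \<Longrightarrow> d2 (d2 \<phi>) (bsq a b x) s = 0"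
  shows "\<exists>p q. \<forall>s. s\<^sup>2 \<le> bsq a b x \<longrightarrow> \<phi> (bsq a b x) s = p + q * s"
proof -
  define u where "u = bsq a b x"
  define r where "r = sqrt u"
  have r: "r > 0" "r\<^sup>2 = u" using u by (auto simp: r_def u_def)
  have sq_le: "s\<^sup>2 \<le> u \<longleftrightarrow> - r \<le> s \<and> s \<le> r" for s
    unfolding r(2)[symmetric] abs_le_square_iff[symmetric] using r(1) by auto
  have sq_less: "s\<^sup>2 < u \<longleftrightarrow> - r < s \<and> s < r" for s
    unfolding r(2)[symmetric] not_le[symmetric] abs_le_square_iff[symmetric] using r(1) by auto
  have inD: "(u, s) \<in> D" if "- r \<le> s" "s \<le> r" for s
    using D_memI[OF x] sq_le that by (simp add: u_def)
  define q where "q = d2 \<phi> u (- r)"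
  have q: "d2 \<phi> u s = q" if "- r \<le> s" "s \<le> r" for s
    unfolding q_def
  proof (rule DERIV_isconst2[OF _ _ _ that])
    show "continuous_on {- r..r} (d2 \<phi> u)"
      using D_isCont(2)[OF smooth_\<phi>_derivs(2) inD] by (auto intro: continuous_at_imp_continuous_on)
    fix t assume t: "- r < t" "t < r"
    then have "d2 (d2 \<phi>) u t = 0" using zero sq_less by (simp add: u_def)
    then show "(d2 \<phi> u has_real_derivative 0) (at t)"
      using has_real_derivative_d2[OF D(1) smooth_\<phi>_derivs(2) inD, of t] t by simp
  qed (use r in auto)
  have lin: "\<phi> u s - q * s = \<phi> u (- r) - q * (- r)" if "- r \<le> s" "s \<le> r" for s
  proof (rule DERIV_isconst2[OF _ _ _ that])
    show "continuous_on {- r..r} (\<lambda>s. \<phi> u s - q * s)"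
      using D_isCont(2)[OF \<phi> inD] by (auto intro!: continuous_at_imp_continuous_on continuous_intros)
    show "((\<lambda>s. \<phi> u s - q * s) has_real_derivative 0) (at t)" if "- r < t" "t < r" for t
      using has_real_derivative_d2[OF D(1) \<phi> inD, of t] q[of t] that
      by (auto intro!: derivative_eq_intros)
  qed (use r in auto)
  have "\<phi> u s = (\<phi> u (- r) - q * (- r)) + q * s" if "s\<^sup>2 \<le> u" for s
    using lin[of s] that unfolding sq_le by linarith
  then show ?thesis unfolding u_def by blast
qed

section \<open>Consequences of Hamel's equation at all points of a connected domain\<close>

context
  assumes dim: "CARD('n) \<ge> 3" and conn: "connected U"
    and flat: "projectively_flat U (alpha a)"
    and phi1: "\<forall>(u, s)\<in>phi_domain U a b. d1 \<phi> u s \<noteq> 0"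
    and hamel: "\<And>x y z. x \<in> U \<Longrightarrow> y \<noteq> 0 \<Longrightarrow> hamel_eq x y z"
begin

lemma d1_nonzero: "x \<in> U \<Longrightarrow> d1 \<phi> (bsq a b x) 0 \<noteq> 0"
  using phi1 bsq_nonneg by (force simp: phi_domain_def)

lemma C_B_eq:
  assumes x: "x \<in> U" and b: "b x \<noteq> 0"
  shows "C x (B x) h = C x (B x) (B x) / bsq a b x * (b x \<bullet> h)"
proof -
  define t where "t = (b x \<bullet> h) / bsq a b x"
  define w where "w = h - t *\<^sub>R B x"
  have "b x \<bullet> w = 0"
    using bsq_pos[OF x b] by (simp add: w_def t_def inner_diff_right bsq_eq)
  then have "C x (B x) w = 0"
    by (intro C_B_perp[OF dim x b hamel[OF x] d1_nonzero[OF x]])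
  moreover have "h = t *\<^sub>R B x + w" by (simp add: w_def)
  ultimately have "C x (B x) h = t * C x (B x) (B x)"
    by (metis C_add_right[OF x] C_scaleR_right[OF x] add.right_neutral)
  then show ?thesis by (simp add: t_def)
qed

text \<open>Constant b^2 makes C(B, .) vanish, and \<open>hamel_even_part\<close> at s1 then reduces
  to phi_22 (u - s1^2) C(v, v) = 0, so both eigenvalues are zero.\<close>

lemma parallel_if_bsq_constant:
  assumes const: "\<And>x. x \<in> U \<Longrightarrow> bsq a b x = u" and "u > 0"
    and s1: "s1\<^sup>2 < u" "d2 (d2 \<phi>) u s1 \<noteq> 0"
  shows "parallel_form U a b"
  unfolding parallel_form_def
proof (intro ballI allI)
  fix x i j assume x: "x \<in> U"
  note u = const[OF x]
  have b: "b x \<noteq> 0" using \<open>u > 0\<close> u by (auto simp: bsq_eq)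
  have CB: "C x (B x) w = 0" for w
    by (rule C_B_eq_0_if_bsq_constant[OF x const])
  obtain s where "s \<noteq> 0" "s\<^sup>2 < bsq a b x" "d2 \<phi> (bsq a b x) s \<noteq> 0"
    using exists_d2_nonzero[OF x, of s1] s1 u by auto
  then have sym: "C x z y = C x y z" for z y
    using C_symmetric[OF dim x b hamel[OF x] CB] by blast
  have Cv: "C x v v = 0" if "v \<bullet> (a x *v v) = 1" "b x \<bullet> v = 0" for v
    using hamel_even_part[OF x b hamel[OF x] CB that, of s1] s1 u by (simp add: CB)
  have "C x z y = 0" for z y
    using C_form_symmetric[OF x b sym CB Cv, of z y] by (simp add: CB)
  then show "cov_deriv a b x i j = 0" by (simp add: cov_deriv_eq[OF x])
qed

context
  assumes nonconst: "\<And>u. \<exists>x\<in>U. bsq a b x \<noteq> u"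
begin

text \<open>On \<open>\<beta> \<noteq> 0\<close> the equation \<open>hamel_at_perp\<close> bounds the differential of \<open>b\<^sup>2\<close> by
  a locally bounded multiple of \<open>\<phi>\<^sub>2\<^sub>2(b\<^sup>2, 0)\<close>.  If \<open>\<phi>\<^sub>2\<^sub>2(u, 0) = 0\<close>, this is at most a
  multiple of \<open>b\<^sup>2 - u\<close> near the level \<open>b\<^sup>2 = u\<close>, and Gronwall makes \<open>b\<^sup>2\<close> constant.\<close>

lemma d22_nonzero:
  assumes x0: "x0 \<in> U" and b0: "b x0 \<noteq> 0"
  shows "d2 (d2 \<phi>) (bsq a b x0) 0 \<noteq> 0"
proof
  define u where "u = bsq a b x0"
  assume "d2 (d2 \<phi>) (bsq a b x0) 0 = 0"
  then have zero: "d2 (d2 \<phi>) u 0 = 0" by (simp add: u_def)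
  have u: "u > 0" using bsq_pos[OF x0 b0] by (simp add: u_def)
  have "bsq a b y = bsq a b x0" if "y \<in> U" for y
  proof (rule bsq_constant_if_gronwall[OF conn x0 _ that])
    fix x assume x: "x \<in> U" and "bsq a b x = bsq a b x0"
    then have bsqx: "bsq a b x = u" by (simp add: u_def)
    have bx: "b x \<noteq> 0" using bsqx u by (auto simp: bsq_eq)
    have "2 \<le> DIM(real^'n)" using dim by simp
    then obtain w0 where w0: "w0 \<noteq> 0" "b x \<bullet> w0 = 0"
      by (rule orthogonal_to_vector_exists[of "b x"]) (auto simp: orthogonal_def)
    \<comment> \<open>A continuous field perpendicular to beta and nonzero near x. It combines two
      fixed vectors, so that continuity of \<open>Db y v\<close> for fixed v is enough
      below.\<close>
    define w where "w y = (b y \<bullet> b x) *\<^sub>R w0 - (b y \<bullet> w0) *\<^sub>R b x" for y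
    have perp: "b y \<bullet> w y = 0" for y by (simp add: w_def inner_diff_right)
    have wx: "w x \<noteq> 0" using w0 bx by (simp add: w_def)
    have cb: "isCont b x" using form x by (rule smooth_on_isCont)
    have ca: "isCont a x" using a_has_derivative[OF x] has_derivative_continuous by blast
    have cDb: "isCont (\<lambda>y. Db y v) x" for v
      using smooth_on_isCont[OF smooth_on_frechet_derivative[OF form] x] .
    have cw: "isCont w x" unfolding w_def by (intro continuous_intros cb)
    \<comment> \<open>This is C(w, w): in \<open>alpha_flat_imp\<close> the Christoffel term carries
      the factor beta(w) = 0, so no derivative of a occurs.\<close>
    define Q where "Q y = (b y \<bullet> b x) * (w y \<bullet> Db y w0) - (b y \<bullet> w0) * (w y \<bullet> Db y (b x))" for y
    have Q: "C y (w y) (w y) = Q y" if "y \<in> U" "w y \<noteq> 0" for y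
    proof -
      have "Db y (w y) = (b y \<bullet> b x) *\<^sub>R Db y w0 - (b y \<bullet> w0) *\<^sub>R Db y (b x)"
        using linear_Db[OF that(1)] by (simp add: w_def linear_diff linear_cmul)
      then show ?thesis
        using alpha_flat_imp(3)[OF flat that] by (simp add: perp Q_def inner_diff_right)
    qed
    define q where "q y = w y \<bullet> (a y *v w y)" for y
    have caw: "isCont (\<lambda>y. a y *v w y) x"
      using bounded_bilinear.continuous[OF bounded_bilinear_matrix_vector ca cw] by simp
    \<comment> \<open>Chosen so that C(B, B) / b^2 = phi_22(b^2, 0) kappa near x; being continuous,
      kappa is locally bounded.\<close>
    define \<kappa> where "\<kappa> y = Q y / (2 * d1 \<phi> (bsq a b y) 0 * q y)" for y
    have "isCont (\<lambda>y. d1 \<phi> (bsq a b y) 0) x"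
      using isCont_o2[OF bsq_isCont[OF x] D_isCont(1)[OF smooth_\<phi>_derivs(1)]] D_memI[OF x] u bsqx
      by simp
    moreover have "2 * d1 \<phi> (bsq a b x) 0 * q x \<noteq> 0"
      using d1_nonzero[OF x] a_pos[OF x wx] by (simp add: q_def)
    ultimately have c\<kappa>: "isCont \<kappa> x"
      unfolding \<kappa>_def Q_def q_def by (intro continuous_intros cb cw cDb caw)
    define M where "M = \<bar>\<kappa> x\<bar> * norm (b x) + 1"
    obtain l where l: "((\<lambda>u. d2 (d2 \<phi>) u 0) has_real_derivative l) (at u)"
      using has_real_derivative_d1[OF D(1) smooth_\<phi>_derivs(4)] D_memI[OF x, of 0] u bsqx by auto
    have "\<forall>\<^sub>F t in nhds u. \<bar>d2 (d2 \<phi>) t 0\<bar> \<le> (\<bar>l\<bar> + 1) * \<bar>t - u\<bar>"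
      using DERIV_eventually_le[OF l] by (simp add: zero)
    moreover have tb: "(bsq a b \<longlongrightarrow> u) (nhds x)"
      using isCont_tendsto_nhds[OF bsq_isCont[OF x]] unfolding bsqx .
    ultimately have ev1: "\<forall>\<^sub>F y in nhds x. \<bar>d2 (d2 \<phi>) (bsq a b y) 0\<bar> \<le> (\<bar>l\<bar> + 1) * \<bar>bsq a b y - u\<bar>"
      unfolding filterlim_iff by blast
    have "isCont (\<lambda>y. \<bar>\<kappa> y\<bar> * norm (b y)) x"
      by (intro continuous_intros c\<kappa> cb)
    then have ev2: "\<forall>\<^sub>F y in nhds x. \<bar>\<kappa> y\<bar> * norm (b y) < M"
      by (rule order_tendstoD(2)[OF isCont_tendsto_nhds]) (simp add: M_def)
    have ev3: "\<forall>\<^sub>F y in nhds x. y \<in> U" using U x eventually_nhds by blast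
    have ev4: "\<forall>\<^sub>F y in nhds x. bsq a b y > 0"
      using tb u by (rule order_tendstoD)
    have ev5: "\<forall>\<^sub>F y in nhds x. w y \<noteq> 0"
      using isCont_tendsto_nhds[OF cw] wx by (rule tendsto_imp_eventually_ne)
    have "\<forall>\<^sub>F y in nhds x. \<forall>h. \<bar>C y (B y) h\<bar> \<le> ((\<bar>l\<bar> + 1) * M) * \<bar>bsq a b y - bsq a b x0\<bar> * norm h"
      using ev1 ev2 ev3 ev4 ev5
    proof eventually_elim
      case (elim y)
      note y = \<open>y \<in> U\<close> and pos = \<open>bsq a b y > 0\<close>
      have b: "b y \<noteq> 0" using pos by (auto simp: bsq_eq)
      obtain t where t: "t > 0" "q y = t\<^sup>2" "(w y /\<^sub>R t) \<bullet> (a y *v (w y /\<^sub>R t)) = 1"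
        using obtain_normalization[OF y \<open>w y \<noteq> 0\<close>] by (metis q_def)
      have "b y \<bullet> (w y /\<^sub>R t) = 0" by (simp add: perp)
      from hamel_at_perp[OF y b hamel[OF y] t(3) this]
      have "d2 (d2 \<phi>) (bsq a b y) 0 * bsq a b y * Q y
          = 2 * d1 \<phi> (bsq a b y) 0 * q y * C y (B y) (B y)"
        using t(1,2) Q[OF y \<open>w y \<noteq> 0\<close>]
        by (simp add: C_scaleR_left[OF y] C_scaleR_right[OF y] field_simps power2_eq_square)
      then have eq: "C y (B y) (B y) / bsq a b y = d2 (d2 \<phi>) (bsq a b y) 0 * \<kappa> y"
        using d1_nonzero[OF y] pos t(1,2) by (simp add: \<kappa>_def field_simps)
      show ?case
      proof
        fix h
        have "\<bar>C y (B y) h\<bar> = \<bar>d2 (d2 \<phi>) (bsq a b y) 0\<bar> * (\<bar>\<kappa> y\<bar> * \<bar>b y \<bullet> h\<bar>)"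
          by (simp add: C_B_eq[OF y b, of h] eq abs_mult)
        also have "\<dots> \<le> ((\<bar>l\<bar> + 1) * \<bar>bsq a b y - u\<bar>) * (M * norm h)"
        proof (rule mult_mono[OF elim(1)])
          have "\<bar>\<kappa> y\<bar> * \<bar>b y \<bullet> h\<bar> \<le> \<bar>\<kappa> y\<bar> * (norm (b y) * norm h)"
            by (intro mult_left_mono Cauchy_Schwarz_ineq2) simp
          also have "\<dots> \<le> M * norm h"
            using elim(2) by (simp add: mult_right_mono flip: mult.assoc)
          finally show "\<bar>\<kappa> y\<bar> * \<bar>b y \<bullet> h\<bar> \<le> M * norm h" .
        qed auto
        finally show "\<bar>C y (B y) h\<bar> \<le> ((\<bar>l\<bar> + 1) * M) * \<bar>bsq a b y - bsq a b x0\<bar> * norm h"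
          by (simp add: u_def mult_ac)
      qed
    qed
    then show "\<exists>K. \<forall>\<^sub>F y in nhds x. \<forall>h. \<bar>C y (B y) h\<bar> \<le> K * \<bar>bsq a b y - bsq a b x0\<bar> * norm h"
      by blast
  qed
  with nonconst show False by blast
qed

definition "c_fun u = 2 * d1 \<phi> u 0 / d2 (d2 \<phi>) u 0"
text \<open>Contracting the equation for b_{i|j} twice with B kills the term with c and leaves k
  b^4.\<close>

definition "k_fun x = C x (B x) (B x) / (bsq a b x)\<^sup>2"

lemma C_unit_perp:
  assumes x: "x \<in> U" and b: "b x \<noteq> 0" and v: "v \<bullet> (a x *v v) = 1" "b x \<bullet> v = 0"
  shows "C x v v = c_fun (bsq a b x) * C x (B x) (B x) / bsq a b x"
  using hamel_at_perp[OF x b hamel[OF x] v] d22_nonzero[OF x b] bsq_pos[OF x b]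
  by (simp add: c_fun_def field_simps)

lemma beta_equation_c_k: "beta_equation U a b c_fun k_fun"
  unfolding beta_equation_def
proof (intro ballI impI)
  fix x assume x: "x \<in> U" and b: "b x \<noteq> 0"
  define u where "u = bsq a b x"
  have u: "u > 0" using bsq_pos[OF x b] by (simp add: u_def)
  have CB: "C x (B x) w = 0" if "b x \<bullet> w = 0" for w
    by (rule C_B_perp[OF dim x b hamel[OF x] d1_nonzero[OF x] that])
  obtain s where "s \<noteq> 0" "s\<^sup>2 < bsq a b x" "d2 \<phi> (bsq a b x) s \<noteq> 0"
    using exists_d2_nonzero[OF x, of 0] d22_nonzero[OF x b] u by (auto simp: u_def)
  then have sym: "C x z y = C x y z" for z y
    using C_symmetric[OF dim x b hamel[OF x] CB] by blast
  define \<mu> where "\<mu> = c_fun u * C x (B x) (B x) / u"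
  have "\<forall>z y. C x z y = \<mu> * (z \<bullet> (a x *v y)) + (C x (B x) (B x) / u\<^sup>2 - \<mu> / u) * (b x \<bullet> z) * (b x \<bullet> y)"
    unfolding \<mu>_def u_def by (intro allI C_form_symmetric[OF x b sym CB C_unit_perp[OF x b]])
  then have cov: "\<forall>i j. cov_deriv a b x i j = \<mu> * a x $ i $ j
      + (C x (B x) (B x) / u\<^sup>2 - \<mu> / u) * b x $ i * b x $ j"
    unfolding C_form_iff[OF x] .
  \<comment> \<open>In the required form a_{ij} has the coefficient k c b^2 and b_i b_j the
    coefficient k - k c.\<close>
  have \<mu>: "\<mu> = k_fun x * c_fun u * u" and \<nu>: "C x (B x) (B x) / u\<^sup>2 - \<mu> / u = k_fun x - k_fun x * c_fun u"
    using u by (simp_all add: k_fun_def \<mu>_def power2_eq_square flip: u_def)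
  show "\<forall>i j. cov_deriv a b x i j =
      k_fun x * c_fun (bsq a b x) * (bsq a b x * a x $ i $ j - b x $ i * b x $ j)
        + k_fun x * b x $ i * b x $ j"
    unfolding cov[rule_format] \<nu> unfolding \<mu> u_def[symmetric] by (simp add: algebra_simps)
qed

text \<open>Inserting the perpendicular eigenvalue into \<open>hamel_even_part\<close> gives C(B, B)
  E = 0, with E the defect of the equation. If E is nonzero at one (u, s), it stays nonzero for
  nearby values of b^2, so d(b^2) vanishes near the level: Gronwall with K = 0.\<close>

lemma phi_equation_c: "phi_equation (phi_domain U a b) \<phi> c_fun"
proof -
  define E where "E u s = (c_fun u * u - (c_fun u - 1) * s\<^sup>2) * d2 (d2 \<phi>) u s
      - 2 * u * (d1 \<phi> u s - s * d1 (d2 \<phi>) u s)" for u s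
  \<comment> \<open>Here q is C(B, B), c q / u the perpendicular eigenvalue, f is phi_22 and g is
    phi_1 - s phi_12.\<close>
  have rescale: "q * ((c * u - (c - 1) * s\<^sup>2) * f - 2 * u * g)
      = u * (f * (s\<^sup>2 * q / u + (u - s\<^sup>2) * (c * q / u)) - 2 * g * q)"
    if "u \<noteq> 0" for c f g q s u :: real
    using that by (simp add: field_simps)
  have interior: "E (bsq a b x0) s = 0" if x0: "x0 \<in> U" and s: "s\<^sup>2 < bsq a b x0" for x0 s
  proof (rule ccontr)
    define u where "u = bsq a b x0"
    assume ne: "E (bsq a b x0) s \<noteq> 0"
    have u: "u > 0" using s le_less_trans[OF zero_le_power2] by (auto simp: u_def)
    have "bsq a b y = bsq a b x0" if "y \<in> U" for y
    proof (rule bsq_constant_if_gronwall[OF conn x0 _ that])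
      fix x assume x: "x \<in> U" and bsqx: "bsq a b x = bsq a b x0"
      have bx: "b x \<noteq> 0" using bsqx u by (auto simp: bsq_eq u_def)
      have inD: "(u, s) \<in> D" "(u, 0) \<in> D"
        using D_memI[OF x] bsqx s u by (auto simp: u_def)
      have "isCont (\<lambda>u. E u s) u"
        unfolding E_def c_fun_def using d22_nonzero[OF x bx] bsqx
        by (intro continuous_intros D_isCont(1)[OF smooth_\<phi>_derivs(1)]
            D_isCont(1)[OF smooth_\<phi>_derivs(3)] D_isCont(1)[OF smooth_\<phi>_derivs(4)] inD)
          (simp_all add: u_def)
      then have "isCont (\<lambda>y. E (bsq a b y) s) x"
        using isCont_o2[OF bsq_isCont[OF x]] bsqx by (simp add: u_def)
      then have ev1: "\<forall>\<^sub>F y in nhds x. E (bsq a b y) s \<noteq> 0"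
        using ne bsqx by (intro tendsto_imp_eventually_ne[OF isCont_tendsto_nhds]) auto
      have "(bsq a b \<longlongrightarrow> bsq a b x) (nhds x)"
        by (rule isCont_tendsto_nhds[OF bsq_isCont[OF x]])
      then have ev2: "\<forall>\<^sub>F y in nhds x. bsq a b y > s\<^sup>2"
        by (rule order_tendstoD) (simp add: s bsqx)
      have ev3: "\<forall>\<^sub>F y in nhds x. y \<in> U" using U x eventually_nhds by blast
      have "\<forall>\<^sub>F y in nhds x. \<forall>h. \<bar>C y (B y) h\<bar> \<le> 0 * \<bar>bsq a b y - bsq a b x0\<bar> * norm h"
        using ev1 ev2 ev3
      proof eventually_elim
        case (elim y)
        have y: "y \<in> U" by fact
        have pos: "bsq a b y > 0" using elim(2) le_less_trans[OF zero_le_power2] by blast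
        have b: "b y \<noteq> 0" using pos by (auto simp: bsq_eq)
        obtain v where v: "v \<bullet> (a y *v v) = 1" "b y \<bullet> v = 0"
          using exists_unit_perp[OF dim y] by metis
        have "C y (B y) v = 0"
          by (rule C_B_perp[OF dim y b hamel[OF y] d1_nonzero[OF y] v(2)])
        then have even: "d2 (d2 \<phi>) (bsq a b y) s *
            (s\<^sup>2 * C y (B y) (B y) / bsq a b y + (bsq a b y - s\<^sup>2) * C y v v)
          = 2 * (d1 \<phi> (bsq a b y) s - s * d1 (d2 \<phi>) (bsq a b y) s) * C y (B y) (B y)"
          by (intro hamel_even_part[OF y b hamel[OF y] _ v elim(2)])
        have "bsq a b y \<noteq> 0" using pos by simp
        from rescale[OF this] have "C y (B y) (B y) * E (bsq a b y) s = 0"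
          unfolding E_def by (simp only: even[unfolded C_unit_perp[OF y b v]] diff_self mult_zero_right)
        with elim(1) have "C y (B y) (B y) = 0" by simp
        then have "C y (B y) h = 0" for h using C_B_eq[OF y b, of h] by simp
        then show ?case by simp
      qed
      then show "\<exists>K. \<forall>\<^sub>F y in nhds x. \<forall>h. \<bar>C y (B y) h\<bar> \<le> K * \<bar>bsq a b y - bsq a b x0\<bar> * norm h"
        by blast
    qed
    with nonconst show False by blast
  qed
  have "E (bsq a b x) s = 0" if x: "x \<in> U" and s: "s\<^sup>2 \<le> bsq a b x" for x s
  proof (cases "bsq a b x = 0")
    \<comment> \<open>Then s = 0 as well, and both sides vanish whatever the value of
      \<open>c_fun 0\<close>.\<close>
    case True
    then show ?thesis using s by (simp add: E_def)
  next
    case False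
    \<comment> \<open>The end points s^2 = b^2 were lost when u - s^2 was cancelled; continuity of E
      in s recovers them.\<close>
    define r where "r = sqrt (bsq a b x)"
    have r: "r > 0" "r\<^sup>2 = bsq a b x" using False bsq_nonneg[OF x] by (auto simp: r_def)
    have "s \<in> {-r..r}"
      using s abs_le_square_iff[of s r] r by (simp add: abs_le_iff)
    then have cl: "s \<in> closure {-r<..<r}" using r by simp
    show ?thesis
    proof (rule continuous_constant_on_closure[OF _ _ cl])
      have "(bsq a b x, t) \<in> D" if "t \<in> {-r..r}" for t
        using D_memI[OF x, of t] abs_le_square_iff[of t r] that r by (simp add: abs_le_iff)
      then show "continuous_on (closure {-r<..<r}) (E (bsq a b x))"
        unfolding E_def using r
        by (auto intro!: continuous_at_imp_continuous_on continuous_intros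
            D_isCont(2)[OF smooth_\<phi>_derivs(1)] D_isCont(2)[OF smooth_\<phi>_derivs(3)]
            D_isCont(2)[OF smooth_\<phi>_derivs(4)])
      show "E (bsq a b x) t = 0" if "t \<in> {-r<..<r}" for t
      proof (rule interior[OF x])
        show "t\<^sup>2 < bsq a b x" using that r abs_le_square_iff[of r t] by (auto simp: abs_if split: if_splits)
      qed
    qed
  qed
  then show ?thesis
    by (auto simp: phi_equation_def phi_domain_def E_def)
qed

end

end

text \<open>Nonconstant b^2 leads to (ii) and constant b^2 to (i). The exceptions in the constant
  case, b^2 = 0 and phi_22 = 0 on the level, give F of the form p alpha + q beta.\<close>

lemma alternatives_if_hamel:
  assumes "CARD('n) \<ge> 3" "connected U" "U \<noteq> {}" "projectively_flat U (alpha a)"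
    and "\<forall>(u, s)\<in>phi_domain U a b. d1 \<phi> u s \<noteq> 0"
    and "\<And>x y z. x \<in> U \<Longrightarrow> y \<noteq> 0 \<Longrightarrow> hamel_eq x y z"
    and non_affine: "\<not> (\<exists>p q. \<forall>x\<in>U. \<forall>y. F x y = p * alpha a x y + q * beta b x y)"
  shows "parallel_form U a b \<or>
    (\<exists>c k. phi_equation (phi_domain U a b) \<phi> c \<and> beta_equation U a b c k)"
proof (cases "\<exists>u. \<forall>x\<in>U. bsq a b x = u")
  case False
  then have nonconst: "\<And>u. \<exists>x\<in>U. bsq a b x \<noteq> u" by blast
  show ?thesis
    using phi_equation_c[OF assms(1,2,4,5,6) nonconst] beta_equation_c_k[OF assms(1,2,4,5,6) nonconst]
    by blast
next
  case True
  then obtain u where u: "\<And>x. x \<in> U \<Longrightarrow> bsq a b x = u" by blast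
  obtain x0 where x0: "x0 \<in> U" using assms(3) by blast
  have "u \<noteq> 0"
  proof
    assume "u = 0"
    have "b x = 0" if "x \<in> U" for x
      using bsq_pos[OF that] u[OF that] \<open>u = 0\<close> by force
    then have "\<forall>x\<in>U. \<forall>y. F x y = \<phi> 0 0 * alpha a x y + 0 * beta b x y"
      using u \<open>u = 0\<close> by (simp add: F_eq)
    with non_affine show False by blast
  qed
  then have "u > 0" using bsq_nonneg[OF x0] u[OF x0] by simp
  show ?thesis
  proof (cases "\<exists>s. s\<^sup>2 < u \<and> d2 (d2 \<phi>) u s \<noteq> 0")
    case True
    then show ?thesis
      using parallel_if_bsq_constant[OF assms(1,2,4,5,6) u \<open>u > 0\<close>] by blast
  next
    case False
    then obtain p q where pq: "\<And>s. s\<^sup>2 \<le> u \<Longrightarrow> \<phi> u s = p + q * s"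
      using affine_if_d22_eq_0[OF x0] u[OF x0] \<open>u > 0\<close> by auto
    have "F x y = p * alpha a x y + q * beta b x y" if x: "x \<in> U" for x y
    proof (cases "y = 0")
      case False
      then show ?thesis
        using pq[of "bs x y"] bs_sq_le[OF x False] alpha_pos[OF x False]
        by (simp add: F_eq u[OF x] beta_def field_simps)
    qed (simp add: F_eq alpha_def beta_def)
    with non_affine show ?thesis by blast
  qed
qed

section \<open>The converse: either alternative implies Hamel's equation\<close>

lemma beta_equation_imp_C:
  assumes "beta_equation U a b c k" "x \<in> U" "b x \<noteq> 0"
  shows "C x z y = k x * c (bsq a b x) * (bsq a b x * (z \<bullet> (a x *v y)) - (b x \<bullet> z) * (b x \<bullet> y))
      + k x * (b x \<bullet> z) * (b x \<bullet> y)"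
proof -
  have "\<forall>i j. cov_deriv a b x i j = (k x * c (bsq a b x) * bsq a b x) * a x $ i $ j
      + (k x - k x * c (bsq a b x)) * b x $ i * b x $ j"
    using assms by (simp add: beta_equation_def algebra_simps)
  then have "C x z y = (k x * c (bsq a b x) * bsq a b x) * (z \<bullet> (a x *v y))
      + (k x - k x * c (bsq a b x)) * (b x \<bullet> z) * (b x \<bullet> y)"
    unfolding C_form_iff[OF assms(2)] by blast
  then show ?thesis by (simp add: algebra_simps)
qed

text \<open>The equation for b_{i|j} is silent at zeros of beta. If the exterior derivative were
  nonzero at x, it would be so nearby, where beta would then have to vanish identically; but then
  its derivative at x is 0.\<close>

lemma C_symmetric_at_zero:
  assumes sym: "\<And>x z y. x \<in> U \<Longrightarrow> b x \<noteq> 0 \<Longrightarrow> C x z y = C x y z" and x: "x \<in> U"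
  shows "C x z y = C x y z"
proof (rule ccontr)
  define curl where "curl x' = z \<bullet> Db x' y - y \<bullet> Db x' z" for x'
  assume "C x z y \<noteq> C x y z"
  then have ne: "curl x \<noteq> 0" using C_curl[OF x, of z y] by (simp add: curl_def)
  have "isCont (\<lambda>y. Db y v) x" for v
    using smooth_on_isCont[OF smooth_on_frechet_derivative[OF form] x] .
  then have "isCont curl x" unfolding curl_def by (intro continuous_intros)
  then have "\<forall>\<^sub>F x' in nhds x. curl x' \<noteq> 0"
    using ne by (intro tendsto_imp_eventually_ne[OF isCont_tendsto_nhds])
  moreover have "\<forall>\<^sub>F x' in nhds x. x' \<in> U" using U x eventually_nhds by blast
  ultimately have "\<forall>\<^sub>F x' in nhds x. b x' = 0"
  proof eventually_elim
    case (elim x')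
    then show ?case using sym[of x' z y] C_curl[of x' z y] by (auto simp: curl_def)
  qed
  then obtain V where V: "open V" "x \<in> V" "\<And>x'. x' \<in> V \<Longrightarrow> b x' = 0"
    unfolding eventually_nhds by auto
  have "(b has_derivative (\<lambda>h. 0)) (at x)"
    by (rule has_derivative_transform_within_open[OF has_derivative_const[of 0] V(1,2)]) (simp add: V(3))
  from has_derivative_unique[OF this b_has_derivative[OF x]] have "Db x v = 0" for v
    by metis
  with ne show False by (simp add: curl_def)
qed

lemma hamel_if_phi_beta_equation:
  assumes c: "phi_equation (phi_domain U a b) \<phi> c" and k: "beta_equation U a b c k"
    and x: "x \<in> U" and y: "y \<noteq> 0"
  shows "hamel_eq x y z"
proof (cases "b x = 0")
  case True
  have "C x z y = C x y z" for z y
    by (rule C_symmetric_at_zero[OF _ x])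
      (simp add: beta_equation_imp_C[OF k] a_sym mult_ac)
  with True x show ?thesis by (intro hamel_eq_at_zero)
next
  case False
  show ?thesis
  proof (rule hamel_eq_if_C_form(1)[OF x y beta_equation_imp_C[OF k x False]])
    have "(bsq a b x, bs x y) \<in> phi_domain U a b"
      using bs_sq_le[OF x y] x by (auto simp: phi_domain_def)
    with c show "(c (bsq a b x) * bsq a b x - (c (bsq a b x) - 1) * (bs x y)\<^sup>2) * \<phi>22 x y
      = 2 * bsq a b x * (\<phi>1 x y - bs x y * \<phi>12 x y)"
      by (auto simp: phi_equation_def)
  qed
qed

lemma parallel_imp_C_eq_0:
  assumes "parallel_form U a b" "x \<in> U"
  shows "C x z y = 0"
  using C_form_iff[OF assms(2), of 0 0] assms by (simp add: parallel_form_def)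

end

text \<open>The open set \<open>D\<close> is there because \<open>phi_domain\<close> contains its
  boundary points s^2 = b^2. The coefficient formula for (ii) is confined to nonzero beta: at a zero
  its correction term is 0 for every k, while b_{i|j} y^i y^j need not vanish, as for
  \<open>\<beta> = \<langle>x, y\<rangle>\<close> at the origin.\<close>

theorem theorem1p1:
  fixes U :: "(real^'n) set"
    and a :: "real^'n \<Rightarrow> real^'n^'n"
    and b :: "real^'n \<Rightarrow> real^'n"
    and \<phi> :: "real \<Rightarrow> real \<Rightarrow> real"
    and D :: "(real \<times> real) set"
    and F :: "real^'n \<Rightarrow> real^'n \<Rightarrow> real"
  assumes dim: "CARD('n) \<ge> 3"
    and U: "open U" "connected U" "U \<noteq> {}"
    and riem: "riemannian_metric U a"
    and form: "smooth_on U b"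
    and phi: "open D" "phi_domain U a b \<subseteq> D" "smooth_on D (\<lambda>(u, s). \<phi> u s)"
    and F: "F = general_ab_metric a b \<phi>"
    and finsler: "finsler_metric U F"
    and non_riem: "\<not> riemannian_on U F"
    and alpha_flat: "projectively_flat U (alpha a)"
    and phi1: "\<forall>(u, s)\<in>phi_domain U a b. d1 \<phi> u s \<noteq> 0"
    and non_affine: "\<not> (\<exists>A B :: real. \<forall>x\<in>U. \<forall>y. F x y = A * alpha a x y + B * beta b x y)"
  shows
    "(projectively_flat U F \<longleftrightarrow>
        parallel_form U a b \<or>
        (\<exists>c k. phi_equation (phi_domain U a b) \<phi> c \<and> beta_equation U a b c k))
     \<and> (parallel_form U a b \<longrightarrow>
        (\<forall>x\<in>U. \<forall>y. y \<noteq> 0 \<longrightarrow> geodesic_coeff F x y = geodesic_coeff (alpha a) x y))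
     \<and> (\<forall>c k. phi_equation (phi_domain U a b) \<phi> c \<and> beta_equation U a b c k \<longrightarrow>
        (\<forall>x\<in>U. \<forall>y. b x \<noteq> 0 \<longrightarrow> y \<noteq> 0 \<longrightarrow>
          (let u = bsq a b x; s = beta b x y / alpha a x y in
            geodesic_coeff F x y = geodesic_coeff (alpha a) x y +
              (k x * alpha a x y *
                ((c u - 1) * ((u - s\<^sup>2) * d2 \<phi> u s / (2 * \<phi> u s))
                  + u * (2 * s * d1 \<phi> u s + d2 \<phi> u s) / (2 * \<phi> u s))) *\<^sub>R y)))"
proof -
  note conn = U(2) and nonempty = U(3)
  interpret general_ab U a b \<phi> D
    by unfold_locales (use U riem form phi in auto)
  have fin: "finsler_metric U (general_ab_metric a b \<phi>)" using finsler by (simp add: F)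
  note flat_iff = F_flat_iff[OF fin alpha_flat] and coeff = geodesic_coeff_F[OF fin alpha_flat]
  have parallel: "hamel_eq x y z" if "parallel_form U a b" "x \<in> U" for x y z
    by (rule hamel_eq_if_C_eq_0) (rule parallel_imp_C_eq_0[OF that])
  have "parallel_form U a b \<or> (\<exists>c k. phi_equation (phi_domain U a b) \<phi> c \<and> beta_equation U a b c k)"
    if "projectively_flat U F"
  proof (rule alternatives_if_hamel[OF dim conn nonempty alpha_flat phi1])
    show "hamel_eq x y z" if "x \<in> U" "y \<noteq> 0" for x y z
      using \<open>projectively_flat U F\<close> that unfolding F flat_iff by blast
  qed (use non_affine in \<open>simp add: F\<close>)
  moreover have "projectively_flat U F"
    if "parallel_form U a b \<or> (\<exists>c k. phi_equation (phi_domain U a b) \<phi> c \<and> beta_equation U a b c k)"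
    using that parallel hamel_if_phi_beta_equation unfolding F flat_iff by blast
  moreover have "geodesic_coeff F x y = geodesic_coeff (alpha a) x y"
    if "parallel_form U a b" "x \<in> U" "y \<noteq> 0" for x y
    using coeff[OF that(2,3) parallel[OF that(1,2)]] parallel_imp_C_eq_0[OF that(1,2)]
    by (simp add: F)
  moreover have "let u = bsq a b x; s = beta b x y / alpha a x y in
            geodesic_coeff F x y = geodesic_coeff (alpha a) x y +
              (k x * alpha a x y *
                ((c u - 1) * ((u - s\<^sup>2) * d2 \<phi> u s / (2 * \<phi> u s))
                  + u * (2 * s * d1 \<phi> u s + d2 \<phi> u s) / (2 * \<phi> u s))) *\<^sub>R y"
    if c: "phi_equation (phi_domain U a b) \<phi> c" and k: "beta_equation U a b c k"
      and x: "x \<in> U" and bx: "b x \<noteq> 0" and y: "y \<noteq> 0" for c k x y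
  proof -
    define u s \<alpha> where "u = bsq a b x" and "s = bs x y" and "\<alpha> = alpha a x y"
    have "(u, s) \<in> phi_domain U a b"
      using bs_sq_le[OF x y] x by (auto simp: phi_domain_def u_def s_def)
    with c have eq: "(c u * u - (c u - 1) * s\<^sup>2) * d2 (d2 \<phi>) u s = 2 * u * (d1 \<phi> u s - s * d1 (d2 \<phi>) u s)"
      by (auto simp: phi_equation_def)
    note C = hamel_eq_if_C_form(2,3)[OF x y beta_equation_imp_C[OF k x bx] eq[unfolded u_def s_def],
        folded u_def s_def \<alpha>_def]
    have \<alpha>: "\<alpha> > 0" using alpha_pos[OF x y] by (simp add: \<alpha>_def)
    have Fxy: "general_ab_metric a b \<phi> x y = \<alpha> * \<phi> u s"
      by (simp only: F_eq u_def s_def \<alpha>_def)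
    have "general_ab_metric a b \<phi> x y > 0" using fin x y by (auto simp: finsler_metric_def)
    then have \<phi>: "\<phi> u s > 0"
      using \<alpha> by (simp add: Fxy zero_less_mult_iff)
    \<comment> \<open>The phi_2 terms agree because c (u - s^2) + s^2 = (c - 1)(u - s^2) +
      u.\<close>
    have "(2 * \<alpha> * d1 \<phi> u s * (k x * u * s * \<alpha>) + d2 \<phi> u s * (k x * \<alpha>\<^sup>2 * (c u * (u - s\<^sup>2) + s\<^sup>2)))
        / (2 * (\<alpha> * \<phi> u s))
      = k x * \<alpha> * ((c u - 1) * ((u - s\<^sup>2) * d2 \<phi> u s / (2 * \<phi> u s))
          + u * (2 * s * d1 \<phi> u s + d2 \<phi> u s) / (2 * \<phi> u s))"
      using \<alpha> \<phi> by (simp add: field_simps power2_eq_square)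
    then have "geodesic_coeff F x y = geodesic_coeff (alpha a) x y +
        (k x * \<alpha> * ((c u - 1) * ((u - s\<^sup>2) * d2 \<phi> u s / (2 * \<phi> u s))
          + u * (2 * s * d1 \<phi> u s + d2 \<phi> u s) / (2 * \<phi> u s))) *\<^sub>R y"
      using coeff[OF x y hamel_if_phi_beta_equation[OF c k x y], folded u_def s_def \<alpha>_def]
      unfolding C Fxy by (simp only: F)
    then show ?thesis
      by (simp only: Let_def beta_def u_def s_def \<alpha>_def)
  qed
  ultimately show ?thesis by blast
qed

end
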